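(* If there exists a polynomial time $\alpha(n)$-approximation algorithm for Network Flow Interdiction (NFI), then there exists a polynomial time $2\alpha(n^2)^2$-approximation algorithm for Densest $k$-Subgraph (D$k$S), where in each case $n$ is the number of vertices of the corresponding instance.
   Context: NFI: an instance consists of an undirected graph $G=(V,E)$ (parallel edges allowed), distinct vertices $s,t\in V$, capacities $u:E\to\mathbb{N}$, costs $c:E\to\mathbb{N}$ and a budget $B$; the goal is to find $R\subseteq E$ with $c(R)=\sum_{e\in R}c(e)\leq B$ minimizing the value of a maximum $s$-$t$-flow in $(V,E\setminus R)$ with capacities $u$. D$k$S: an instance is a simple undirected graph $H$ and an integer $0<k<|V(H)|$; the goal is to find a set $W$ of $k$ vertices maximizing the number of edges of the induced subgraph $H[W]$. An $\alpha$-approximation algorithm for a minimization problem is a polynomial time algorithm producing a feasible solution of objective value at most $\alpha\cdot\mathrm{OPT}$; for a maximization problem the objective value is at least $\mathrm{OPT}/\alpha$. *)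

theory Defs
  imports Complex_Main "HOL-Library.Log_Nat" "HOL-Computational_Algebra.Polynomial"
begin

section \<open>Polynomial time\<close>

text \<open>
  The machine model is the language of while programs over binary trees with numbers at the
  leaves. Costs are logarithmic: evaluating an expression costs the total size, in bits, of all
  intermediate values. A run of cost \<open>t\<close> on an input of size \<open>N\<close> therefore only handles values of
  size at most \<open>N + t\<close> up to constant factors, and simulations by and of Turing machines have
  polynomial overhead in both directions.
\<close>

datatype val = VNum nat | VPair val val

text \<open>The number of binary digits of \<open>n\<close> is \<open>floorlog 2 n\<close> (and \<open>0\<close> for \<open>n = 0\<close>).\<close>

primrec vsize :: "val \<Rightarrow> nat" where
  "vsize (VNum n) = Suc (floorlog 2 n)"
| "vsize (VPair a b) = Suc (vsize a + vsize b)"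

type_synonym state = "nat \<Rightarrow> val"

datatype expr =
    Var nat
  | Lit nat
  | MkPair expr expr
  | Fst expr
  | Snd expr
  | Plus expr expr
  | Minus expr expr
  | Less expr expr
  | Eq expr expr

text \<open>
  All operations are total: projections of a number are \<open>0\<close>, a pair counts as \<open>0\<close> in arithmetic,
  and subtraction is truncated.
\<close>

primrec val_fst :: "val \<Rightarrow> val" where
  "val_fst (VNum n) = VNum 0"
| "val_fst (VPair a b) = a"

primrec val_snd :: "val \<Rightarrow> val" where
  "val_snd (VNum n) = VNum 0"
| "val_snd (VPair a b) = b"

primrec val_num :: "val \<Rightarrow> nat" where
  "val_num (VNum n) = n"
| "val_num (VPair a b) = 0"

primrec eval :: "expr \<Rightarrow> state \<Rightarrow> val" where
  "eval (Var x) s = s x"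
| "eval (Lit n) s = VNum n"
| "eval (MkPair a b) s = VPair (eval a s) (eval b s)"
| "eval (Fst a) s = val_fst (eval a s)"
| "eval (Snd a) s = val_snd (eval a s)"
| "eval (Plus a b) s = VNum (val_num (eval a s) + val_num (eval b s))"
| "eval (Minus a b) s = VNum (val_num (eval a s) - val_num (eval b s))"
| "eval (Less a b) s = VNum (if val_num (eval a s) < val_num (eval b s) then 1 else 0)"
| "eval (Eq a b) s = VNum (if eval a s = eval b s then 1 else 0)"

primrec eval_cost :: "expr \<Rightarrow> state \<Rightarrow> nat" where
  "eval_cost (Var x) s = vsize (eval (Var x) s)"
| "eval_cost (Lit n) s = vsize (eval (Lit n) s)"
| "eval_cost (MkPair a b) s = vsize (eval (MkPair a b) s) + eval_cost a s + eval_cost b s"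
| "eval_cost (Fst a) s = vsize (eval (Fst a) s) + eval_cost a s"
| "eval_cost (Snd a) s = vsize (eval (Snd a) s) + eval_cost a s"
| "eval_cost (Plus a b) s = vsize (eval (Plus a b) s) + eval_cost a s + eval_cost b s"
| "eval_cost (Minus a b) s = vsize (eval (Minus a b) s) + eval_cost a s + eval_cost b s"
| "eval_cost (Less a b) s = vsize (eval (Less a b) s) + eval_cost a s + eval_cost b s"
| "eval_cost (Eq a b) s = vsize (eval (Eq a b) s) + eval_cost a s + eval_cost b s"

datatype com =
    Skip
  | Assign nat expr
  | Seq com com
  | If expr com com
  | While expr com

text \<open>
  \<open>exec c s t s'\<close>: started in \<open>s\<close>, the program \<open>c\<close> terminates in \<open>s'\<close> after time \<open>t\<close>. A test
  succeeds iff its value is different from \<open>VNum 0\<close>.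
\<close>

inductive exec :: "com \<Rightarrow> state \<Rightarrow> nat \<Rightarrow> state \<Rightarrow> bool" where
  Skip: "exec Skip s 1 s"
| Assign: "exec (Assign x e) s (1 + eval_cost e s) (s(x := eval e s))"
| Seq: "exec c1 s1 t1 s2 \<Longrightarrow> exec c2 s2 t2 s3 \<Longrightarrow> exec (Seq c1 c2) s1 (1 + t1 + t2) s3"
| IfTrue: "eval b s \<noteq> VNum 0 \<Longrightarrow> exec c1 s t s' \<Longrightarrow>
    exec (If b c1 c2) s (1 + eval_cost b s + t) s'"
| IfFalse: "eval b s = VNum 0 \<Longrightarrow> exec c2 s t s' \<Longrightarrow>
    exec (If b c1 c2) s (1 + eval_cost b s + t) s'"
| WhileFalse: "eval b s = VNum 0 \<Longrightarrow> exec (While b c) s (1 + eval_cost b s) s"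
| WhileTrue: "eval b s1 \<noteq> VNum 0 \<Longrightarrow> exec c s1 t1 s2 \<Longrightarrow> exec (While b c) s2 t2 s3 \<Longrightarrow>
    exec (While b c) s1 (1 + eval_cost b s1 + t1 + t2) s3"

definition input_state :: "val \<Rightarrow> state" where
  "input_state v = (\<lambda>_. VNum 0)(0 := v)"

text \<open>
  Input and output are passed in variable \<open>0\<close>. The relation \<open>good I v\<close> says that the output \<open>v\<close> is
  acceptable on the instance \<open>I\<close>. Nothing is required on inputs that encode no valid instance.
\<close>

definition poly_time_algorithm ::
  "('i \<Rightarrow> bool) \<Rightarrow> ('i \<Rightarrow> val) \<Rightarrow> ('i \<Rightarrow> val \<Rightarrow> bool) \<Rightarrow> com \<Rightarrow> bool" where
  "poly_time_algorithm valid enc good c \<longleftrightarrow>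
    (\<exists>p :: nat poly. \<forall>I. valid I \<longrightarrow>
      (\<exists>t s. exec c (input_state (enc I)) t s \<and> t \<le> poly p (vsize (enc I)) \<and> good I (s 0)))"

definition enc_list :: "('a \<Rightarrow> val) \<Rightarrow> 'a list \<Rightarrow> val" where
  "enc_list f xs = foldr (\<lambda>x v. VPair (f x) v) xs (VNum 0)"

definition encodes_set :: "val \<Rightarrow> nat set \<Rightarrow> bool" where
  "encodes_set v S \<longleftrightarrow> (\<exists>xs. distinct xs \<and> set xs = S \<and> v = enc_list VNum xs)"


section \<open>Network flow interdiction\<close>

text \<open>
  The vertices are \<open>{..<nfi_n I}\<close>. Edges are identified with their positions in the list
  \<open>nfi_edges I\<close>, so that parallel edges are possible. Edges are undirected; the order of the two
  ends only fixes the sign convention for flows.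
\<close>

record nfi_edge =
  end1 :: nat
  end2 :: nat
  capacity :: nat
  cost :: nat

record nfi =
  nfi_n :: nat
  nfi_source :: nat
  nfi_sink :: nat
  nfi_edges :: "nfi_edge list"
  nfi_budget :: nat

definition nfi_E :: "nfi \<Rightarrow> nat set" where
  "nfi_E I = {..<length (nfi_edges I)}"

definition nfi_valid :: "nfi \<Rightarrow> bool" where
  "nfi_valid I \<longleftrightarrow>
    nfi_source I < nfi_n I \<and> nfi_sink I < nfi_n I \<and> nfi_source I \<noteq> nfi_sink I \<and>
    (\<forall>e \<in> set (nfi_edges I). end1 e < nfi_n I \<and> end2 e < nfi_n I \<and> end1 e \<noteq> end2 e)"

text \<open>
  A flow assigns to each edge a signed real, positive in the direction from \<open>end1\<close> to \<open>end2\<close>.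
  The set \<open>F\<close> consists of the edges present in the network.
\<close>

definition net_outflow :: "nfi \<Rightarrow> nat set \<Rightarrow> (nat \<Rightarrow> real) \<Rightarrow> nat \<Rightarrow> real" where
  "net_outflow I F f v =
    (\<Sum>i \<in> {i \<in> F. end1 (nfi_edges I ! i) = v}. f i) -
    (\<Sum>i \<in> {i \<in> F. end2 (nfi_edges I ! i) = v}. f i)"

definition is_flow :: "nfi \<Rightarrow> nat set \<Rightarrow> (nat \<Rightarrow> real) \<Rightarrow> bool" where
  "is_flow I F f \<longleftrightarrow>
    (\<forall>i \<in> F. \<bar>f i\<bar> \<le> real (capacity (nfi_edges I ! i))) \<and>
    (\<forall>v < nfi_n I. v \<noteq> nfi_source I \<longrightarrow> v \<noteq> nfi_sink I \<longrightarrow> net_outflow I F f v = 0)"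

text \<open>The supremum is attained: flow values range over a nonempty compact set.\<close>

definition max_flow_value :: "nfi \<Rightarrow> nat set \<Rightarrow> real" where
  "max_flow_value I F = Sup {net_outflow I F f (nfi_source I) | f. is_flow I F f}"

definition nfi_feasible :: "nfi \<Rightarrow> nat set \<Rightarrow> bool" where
  "nfi_feasible I R \<longleftrightarrow>
    R \<subseteq> nfi_E I \<and> (\<Sum>i \<in> R. cost (nfi_edges I ! i)) \<le> nfi_budget I"

definition nfi_value :: "nfi \<Rightarrow> nat set \<Rightarrow> real" where
  "nfi_value I R = max_flow_value I (nfi_E I - R)"

definition nfi_opt :: "nfi \<Rightarrow> real" where
  "nfi_opt I = Min (nfi_value I ` {R. nfi_feasible I R})"

text \<open>
  In both problems the vertices are listed explicitly, so that the input size is at least the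
  number of vertices, while capacities, costs and the budget are encoded in binary.
\<close>

definition enc_nfi_edge :: "nfi_edge \<Rightarrow> val" where
  "enc_nfi_edge e =
    VPair (VNum (end1 e)) (VPair (VNum (end2 e)) (VPair (VNum (capacity e)) (VNum (cost e))))"

definition enc_nfi :: "nfi \<Rightarrow> val" where
  "enc_nfi I =
    VPair (enc_list VNum [0..<nfi_n I])
      (VPair (VNum (nfi_source I)) (VPair (VNum (nfi_sink I))
        (VPair (enc_list enc_nfi_edge (nfi_edges I)) (VNum (nfi_budget I)))))"

definition nfi_approx_algorithm :: "(nat \<Rightarrow> real) \<Rightarrow> com \<Rightarrow> bool" where
  "nfi_approx_algorithm \<alpha> =
    poly_time_algorithm nfi_valid enc_nfi
      (\<lambda>I v. \<exists>R. encodes_set v R \<and> nfi_feasible I R \<and>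
        nfi_value I R \<le> \<alpha> (nfi_n I) * nfi_opt I)"


section \<open>Densest \<open>k\<close>-subgraph\<close>

text \<open>The vertices are \<open>{..<dks_n H}\<close>.\<close>

record dks =
  dks_n :: nat
  dks_edges :: "(nat \<times> nat) list"
  dks_k :: nat

definition dks_E :: "dks \<Rightarrow> nat set set" where
  "dks_E H = (\<lambda>(u, v). {u, v}) ` set (dks_edges H)"

definition dks_valid :: "dks \<Rightarrow> bool" where
  "dks_valid H \<longleftrightarrow>
    (\<forall>(u, v) \<in> set (dks_edges H). u < dks_n H \<and> v < dks_n H \<and> u \<noteq> v) \<and>
    distinct (map (\<lambda>(u, v). {u, v}) (dks_edges H)) \<and>
    0 < dks_k H \<and> dks_k H < dks_n H"

definition dks_feasible :: "dks \<Rightarrow> nat set \<Rightarrow> bool" where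
  "dks_feasible H W \<longleftrightarrow> W \<subseteq> {..<dks_n H} \<and> card W = dks_k H"

definition dks_value :: "dks \<Rightarrow> nat set \<Rightarrow> nat" where
  "dks_value H W = card {e \<in> dks_E H. e \<subseteq> W}"

definition dks_opt :: "dks \<Rightarrow> nat" where
  "dks_opt H = Max (dks_value H ` {W. dks_feasible H W})"

definition enc_dks_edge :: "nat \<times> nat \<Rightarrow> val" where
  "enc_dks_edge e = VPair (VNum (fst e)) (VNum (snd e))"

definition enc_dks :: "dks \<Rightarrow> val" where
  "enc_dks H =
    VPair (enc_list VNum [0..<dks_n H])
      (VPair (enc_list enc_dks_edge (dks_edges H)) (VNum (dks_k H)))"

definition dks_approx_algorithm :: "(nat \<Rightarrow> real) \<Rightarrow> com \<Rightarrow> bool" where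
  "dks_approx_algorithm \<alpha> =
    poly_time_algorithm dks_valid enc_dks
      (\<lambda>H v. \<exists>W. encodes_set v W \<and> dks_feasible H W \<and>
        real (dks_value H W) \<ge> real (dks_opt H) / \<alpha> (dks_n H))"

end

theory Submission
  imports Defs
begin

text \<open>
  For a budget \<open>b = 2 (m - l)\<close> replace each edge \<open>uw\<close> of \<open>H\<close> by a triangle on \<open>u\<close>, \<open>w\<close> and the sink whose
  edges have cost \<open>1\<close> and capacity \<open>2\<close>, and join the source to every vertex by an edge of capacity \<open>1\<close>
  that is too expensive to remove. Cutting off everything except a vertex set \<open>S\<close> costs \<open>2\<close> for each
  edge not inside \<open>S\<close> and leaves a flow of value at most \<open>|S|\<close>. Conversely, after any feasible
  removal at least \<open>l\<close> triangles have lost at most one edge; all \<open>w\<close> vertices on them can still send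
  one unit to the sink. Hence the optimum is the least size of a vertex set spanning \<open>l\<close> edges,
  and an approximate solution yields \<open>w \<le> \<alpha> k\<close> vertices spanning \<open>l\<close> edges when \<open>l\<close> is the optimum
  of D\<open>k\<close>S. Greedily deleting vertices down to \<open>k\<close> keeps a fraction \<open>k (k - 1) / (w (w - 1))\<close> of the
  edges, which is at least \<open>1 / (2 \<alpha>\<^sup>2)\<close>. As \<open>\<alpha>\<close> need not be computable, all \<open>l\<close> are tried.

  Polynomial running time follows from closure properties of the functions on values that
  are computable in polynomial time, the crucial one being recursion over lists with results
  of polynomial size.
\<close>

section \<open>Polynomial bounds\<close>

text \<open>Capacity \<open>2\<close> on the triangle edges lets every spanned vertex send its own
  unit of flow: an edge of a triangle is used only by the paths of the two ends of the underlying
  edge of \<open>H\<close>. In the ratio, \<open>\<alpha>\<close> is squared because the number of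
  possible edges grows with the square of the number of vertices, and the factor \<open>2\<close> is
  the price of replacing \<open>k\<close> by \<open>k - 1\<close>; a positive optimum forces
  \<open>k \<ge> 2\<close>. Two obstacles shape the formal proof. First, \<open>\<alpha>\<close> is
  an arbitrary real function, so even \<open>\<alpha> \<ge> 1\<close> has to be recovered, at the
  one argument that matters, from an instance with positive optimum. Second, the machine has no
  procedures: programs are combined by saving data in fresh variables, and since repeating a
  polynomial time step can produce exponentially large values, every iteration comes with its own
  bound on the intermediate results.\<close>

definition poly_bounded :: "'i set \<Rightarrow> ('i \<Rightarrow> nat) \<Rightarrow> ('i \<Rightarrow> nat) \<Rightarrow> bool" where
  "poly_bounded V a b \<longleftrightarrow> (\<exists>p :: nat poly. \<forall>i\<in>V. b i \<le> poly p (a i))"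

text \<open>Coefficients are natural numbers, so nothing can decrease. This allows a size inside a
  time bound to be replaced by a larger one.\<close>

lemma poly_mono_nat: "x \<le> y \<Longrightarrow> poly p x \<le> poly p y" for p :: "nat poly"
  by (induction p) (auto intro!: add_mono mult_mono)

lemma poly_boundedI: "(\<And>i. i \<in> V \<Longrightarrow> b i \<le> poly p (a i)) \<Longrightarrow> poly_bounded V a b"
  unfolding poly_bounded_def by blast

lemma poly_bounded_const: "poly_bounded V a (\<lambda>_. n)"
  by (rule poly_boundedI[where p = "[:n:]"]) simp

lemma poly_bounded_refl: "poly_bounded V a a"
  by (rule poly_boundedI[where p = "[:0, 1:]"]) simp

lemma poly_bounded_add:
  assumes "poly_bounded V a b" "poly_bounded V a c"
  shows "poly_bounded V a (\<lambda>i. b i + c i)"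
proof -
  obtain p q where "\<forall>i\<in>V. b i \<le> poly p (a i)" "\<forall>i\<in>V. c i \<le> poly q (a i)"
    using assms unfolding poly_bounded_def by blast
  then show ?thesis by (intro poly_boundedI[where p = "p + q"]) (simp add: add_mono)
qed

lemma poly_bounded_mult:
  assumes "poly_bounded V a b" "poly_bounded V a c"
  shows "poly_bounded V a (\<lambda>i. b i * c i)"
proof -
  obtain p q where "\<forall>i\<in>V. b i \<le> poly p (a i)" "\<forall>i\<in>V. c i \<le> poly q (a i)"
    using assms unfolding poly_bounded_def by blast
  then show ?thesis by (intro poly_boundedI[where p = "p * q"]) (simp add: mult_mono)
qed

lemma poly_bounded_trans:
  assumes "poly_bounded V a b" "poly_bounded V b c"
  shows "poly_bounded V a c"
proof -
  obtain p q where p: "\<forall>i\<in>V. b i \<le> poly p (a i)" and q: "\<forall>i\<in>V. c i \<le> poly q (b i)"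
    using assms unfolding poly_bounded_def by blast
  have "c i \<le> poly (q \<circ>\<^sub>p p) (a i)" if "i \<in> V" for i
    unfolding poly_pcompose using p q poly_mono_nat that by (meson le_trans)
  then show ?thesis by (rule poly_boundedI)
qed

lemma poly_bounded_le:
  "poly_bounded V a b \<Longrightarrow> (\<And>i. i \<in> V \<Longrightarrow> c i \<le> b i) \<Longrightarrow> poly_bounded V a c"
  unfolding poly_bounded_def by (meson le_trans)

lemma poly_bounded_poly: "poly_bounded V a b \<Longrightarrow> poly_bounded V a (\<lambda>i. poly p (b i))"
  by (rule poly_bounded_trans, assumption) (rule poly_boundedI, rule order_refl)

lemma poly_bounded_reindex:
  "poly_bounded V a b \<Longrightarrow> (\<And>j. j \<in> W \<Longrightarrow> g j \<in> V) \<Longrightarrow>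
    poly_bounded W (\<lambda>j. a (g j)) (\<lambda>j. b (g j))"
  unfolding poly_bounded_def by blast

lemmas poly_bounded_intros =
  poly_bounded_const poly_bounded_refl poly_bounded_add poly_bounded_mult poly_bounded_poly


section \<open>Program runs\<close>

text \<open>An index from which on no variable occurs, rather than the set of variables: it directly
  supplies fresh variables for saving intermediate results.\<close>

primrec expr_bound :: "expr \<Rightarrow> nat" where
  "expr_bound (Var x) = Suc x"
| "expr_bound (Lit n) = 0"
| "expr_bound (MkPair a b) = max (expr_bound a) (expr_bound b)"
| "expr_bound (Fst a) = expr_bound a"
| "expr_bound (Snd a) = expr_bound a"
| "expr_bound (Plus a b) = max (expr_bound a) (expr_bound b)"
| "expr_bound (Minus a b) = max (expr_bound a) (expr_bound b)"
| "expr_bound (Less a b) = max (expr_bound a) (expr_bound b)"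
| "expr_bound (Eq a b) = max (expr_bound a) (expr_bound b)"

primrec com_bound :: "com \<Rightarrow> nat" where
  "com_bound Skip = 0"
| "com_bound (Assign x e) = max (Suc x) (expr_bound e)"
| "com_bound (Seq c d) = max (com_bound c) (com_bound d)"
| "com_bound (If b c d) = max (expr_bound b) (max (com_bound c) (com_bound d))"
| "com_bound (While b c) = max (expr_bound b) (com_bound c)"

lemma vsize_pos: "0 < vsize v"
  by (cases v) auto

lemma eval_agree:
  "\<forall>x<expr_bound e. s x = s' x \<Longrightarrow> eval e s = eval e s' \<and> eval_cost e s = eval_cost e s'"
  by (induction e) auto

text \<open>Serves in place of a call stack: data stored at or above \<open>com_bound c\<close>
  survives a run of \<open>c\<close>.\<close>

lemma exec_frame: "exec c s t s' \<Longrightarrow> com_bound c \<le> x \<Longrightarrow> s' x = s x"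
  by (induction rule: exec.induct) auto

text \<open>Lets a program whose behaviour is known from one particular state be run while other
  data is kept in variables above its bound.\<close>

lemma exec_agree:
  "exec c s t s' \<Longrightarrow> com_bound c \<le> m \<Longrightarrow> \<forall>x<m. r x = s x \<Longrightarrow>
    \<exists>r'. exec c r t r' \<and> (\<forall>x<m. r' x = s' x)"
proof (induction arbitrary: r rule: exec.induct)
  case (Skip s)
  then show ?case using exec.Skip by blast
next
  case (Assign x e s)
  then have "eval e r = eval e s" "eval_cost e r = eval_cost e s"
    using eval_agree[of e r s] by auto
  then show ?case
    using exec.Assign[of x e r] Assign by (intro exI[of _ "r(x := eval e r)"]) (simp del: fun_upd_apply, simp)
next
  case (Seq c1 s1 t1 s2 c2 t2 s3)
  then obtain r2 where r2: "exec c1 r t1 r2" "\<forall>x<m. r2 x = s2 x"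
    by (metis com_bound.simps(3) max.bounded_iff)
  moreover obtain r3 where "exec c2 r2 t2 r3" "\<forall>x<m. r3 x = s3 x"
    using Seq.IH(2)[of r2] Seq.prems r2 by auto
  ultimately show ?case using exec.Seq by blast
next
  case (IfTrue b s c1 t s' c2)
  then have e: "eval b r = eval b s" "eval_cost b r = eval_cost b s"
    using eval_agree[of b r s] by auto
  obtain r' where "exec c1 r t r'" "\<forall>x<m. r' x = s' x"
    using IfTrue.IH[of r] IfTrue.prems by auto
  then show ?case using exec.IfTrue[of b r c1 t r' c2] e IfTrue.hyps by auto
next
  case (IfFalse b s c2 t s' c1)
  then have e: "eval b r = eval b s" "eval_cost b r = eval_cost b s"
    using eval_agree[of b r s] by auto
  obtain r' where "exec c2 r t r'" "\<forall>x<m. r' x = s' x"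
    using IfFalse.IH[of r] IfFalse.prems by auto
  then show ?case using exec.IfFalse[of b r c2 t r' c1] e IfFalse.hyps by auto
next
  case (WhileFalse b s c)
  then have e: "eval b r = eval b s" "eval_cost b r = eval_cost b s"
    using eval_agree[of b r s] by auto
  then show ?case using exec.WhileFalse[of b r c] WhileFalse by auto
next
  case (WhileTrue b s1 c t1 s2 t2 s3)
  then have e: "eval b r = eval b s1" "eval_cost b r = eval_cost b s1"
    using eval_agree[of b r s1] by auto
  obtain r2 where r2: "exec c r t1 r2" "\<forall>x<m. r2 x = s2 x"
    using WhileTrue.IH(1)[of r] WhileTrue.prems by auto
  obtain r3 where "exec (While b c) r2 t2 r3" "\<forall>x<m. r3 x = s3 x"
    using WhileTrue.IH(2)[of r2] WhileTrue.prems r2 by auto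
  then show ?case using exec.WhileTrue[of b r c t1 r2 t2 r3] e WhileTrue.hyps r2 by auto
qed

lemma vsize_eval_le: "vsize (eval e s) \<le> eval_cost e s"
  by (induction e) auto

text \<open>An assignment is charged at least the size of the value it writes, so no value can grow
  faster than the clock.\<close>

lemma exec_vsize_le: "exec c s t s' \<Longrightarrow> vsize (s' x) \<le> vsize (s x) + t"
proof (induction rule: exec.induct)
  case (Assign y e s)
  then show ?case using vsize_eval_le[of e s] by (simp add: trans_le_add2)
qed auto

section \<open>Bit lengths and the cost of one expression\<close>

lemma vsize_val_fst: "vsize (val_fst v) \<le> vsize v"
  by (cases v) (auto simp: floorlog_def)

lemma vsize_val_snd: "vsize (val_snd v) \<le> vsize v"
  by (cases v) (auto simp: floorlog_def)

lemma floorlog_le_iff_less_power: "floorlog 2 n \<le> k \<longleftrightarrow> n < 2 ^ k"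
  using floorlog_leI[of n 2 k] floorlog_bounds[of n 2]
  by (cases "n = 0") (auto simp: floorlog_def dest: power_increasing[of _ k "2::nat"])

lemma floorlog_add_le: "floorlog 2 (a + b) \<le> Suc (floorlog 2 a + floorlog 2 b)"
proof -
  have "a < 2 ^ (floorlog 2 a + floorlog 2 b)" "b < 2 ^ (floorlog 2 a + floorlog 2 b)"
    by (simp_all flip: floorlog_le_iff_less_power)
  then show ?thesis unfolding floorlog_le_iff_less_power by simp
qed

lemma floorlog_mono2: "a \<le> b \<Longrightarrow> floorlog 2 a \<le> floorlog 2 b"
  unfolding floorlog_le_iff_less_power using floorlog_le_iff_less_power le_less_trans by blast

lemma vsize_val_num: "Suc (floorlog 2 (val_num v)) \<le> vsize v"
  by (cases v) (auto simp: floorlog_def)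

lemma floorlog_0: "floorlog 2 0 = 0" and floorlog_1: "floorlog 2 (Suc 0) = 1"
  by (auto simp: floorlog_def)

text \<open>Up to a constant, the result of each operator is no longer than its operands together,
  whose sizes are bounded by their costs through \<open>vsize_eval_le\<close>. Additive constants
  are absorbed because \<open>vsize\<close> is positive.\<close>

lemma eval_cost_linear:
  "expr_bound e \<le> 1 \<Longrightarrow> \<exists>C. \<forall>s. eval_cost e s \<le> C * vsize (s 0)"
proof (induction e)
  case (Var x)
  then show ?case by (intro exI[of _ 1]) simp
next
  case (Lit n)
  have "Suc (floorlog 2 n) \<le> Suc (floorlog 2 n) * vsize (s 0)" for s :: state
    using mult_le_mono2[of 1 "vsize (s 0)" "Suc (floorlog 2 n)"] vsize_pos[of "s 0"] by simp
  then show ?case by (intro exI[of _ "Suc (floorlog 2 n)"]) simp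
next
  case (MkPair a b)
  then obtain C D where C: "\<And>s. eval_cost a s \<le> C * vsize (s 0)" and D: "\<And>s. eval_cost b s \<le> D * vsize (s 0)"
    by auto
  have "eval_cost (MkPair a b) s \<le> (1 + 2 * C + 2 * D) * vsize (s 0)" for s
    using C[of s] D[of s] vsize_eval_le[of a s] vsize_eval_le[of b s] vsize_pos[of "s 0"]
    by (simp add: algebra_simps)
  then show ?case by blast
next
  case (Fst a)
  then obtain C where C: "\<And>s. eval_cost a s \<le> C * vsize (s 0)" by auto
  have "eval_cost (Fst a) s \<le> (2 * C) * vsize (s 0)" for s
    using C[of s] vsize_eval_le[of a s] vsize_val_fst[of "eval a s"] by (simp add: algebra_simps)
  then show ?case by blast
next
  case (Snd a)
  then obtain C where C: "\<And>s. eval_cost a s \<le> C * vsize (s 0)" by auto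
  have "eval_cost (Snd a) s \<le> (2 * C) * vsize (s 0)" for s
    using C[of s] vsize_eval_le[of a s] vsize_val_snd[of "eval a s"] by (simp add: algebra_simps)
  then show ?case by blast
next
  case (Plus a b)
  then obtain C D where C: "\<And>s. eval_cost a s \<le> C * vsize (s 0)" and D: "\<And>s. eval_cost b s \<le> D * vsize (s 0)"
    by auto
  have "eval_cost (Plus a b) s \<le> (2 * C + 2 * D) * vsize (s 0)" for s
    using C[of s] D[of s] vsize_eval_le[of a s] vsize_eval_le[of b s]
      vsize_val_num[of "eval a s"] vsize_val_num[of "eval b s"]
      floorlog_add_le[of "val_num (eval a s)" "val_num (eval b s)"]
    by (simp add: algebra_simps)
  then show ?case by blast
next
  case (Minus a b)
  then obtain C D where C: "\<And>s. eval_cost a s \<le> C * vsize (s 0)" and D: "\<And>s. eval_cost b s \<le> D * vsize (s 0)"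
    by auto
  have "eval_cost (Minus a b) s \<le> (2 * C + D) * vsize (s 0)" for s
    using C[of s] D[of s] vsize_eval_le[of a s] vsize_val_num[of "eval a s"]
      floorlog_mono2[of "val_num (eval a s) - val_num (eval b s)" "val_num (eval a s)"]
    by (simp add: algebra_simps)
  then show ?case by blast
next
  case (Less a b)
  then obtain C D where C: "\<And>s. eval_cost a s \<le> C * vsize (s 0)" and D: "\<And>s. eval_cost b s \<le> D * vsize (s 0)"
    by auto
  have "eval_cost (Less a b) s \<le> (2 + C + D) * vsize (s 0)" for s
    using C[of s] D[of s] vsize_pos[of "s 0"] by (simp add: algebra_simps floorlog_0 floorlog_1)
  then show ?case by blast
next
  case (Eq a b)
  then obtain C D where C: "\<And>s. eval_cost a s \<le> C * vsize (s 0)" and D: "\<And>s. eval_cost b s \<le> D * vsize (s 0)"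
    by auto
  have "eval_cost (Eq a b) s \<le> (2 + C + D) * vsize (s 0)" for s
    using C[of s] D[of s] vsize_pos[of "s 0"] by (simp add: algebra_simps floorlog_0 floorlog_1)
  then show ?case by blast
qed

section \<open>Polynomial-time computability\<close>

text \<open>
  The initial contents of the variables other than \<open>0\<close> are arbitrary, so that programs can be
  reused inside loops.
\<close>

definition poly_comp :: "'i set \<Rightarrow> ('i \<Rightarrow> val) \<Rightarrow> ('i \<Rightarrow> val) \<Rightarrow> bool" where
  "poly_comp V a b \<longleftrightarrow> (\<exists>c T. poly_bounded V (\<lambda>i. vsize (a i)) T \<and>
    (\<forall>i\<in>V. \<forall>s. s 0 = a i \<longrightarrow> (\<exists>t s'. exec c s t s' \<and> t \<le> T i \<and> s' 0 = b i)))"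

lemma poly_compE:
  assumes "poly_comp V a b"
  obtains T c where "poly_bounded V (\<lambda>i. vsize (a i)) T"
    "\<And>i s. i \<in> V \<Longrightarrow> s 0 = a i \<Longrightarrow> \<exists>t s'. exec c s t s' \<and> t \<le> T i \<and> s' 0 = b i"
  using assms that unfolding poly_comp_def by meson

lemma poly_compI:
  assumes "poly_bounded V (\<lambda>i. vsize (a i)) T"
    "\<And>i s. i \<in> V \<Longrightarrow> s 0 = a i \<Longrightarrow> \<exists>t s'. exec c s t s' \<and> t \<le> T i \<and> s' 0 = b i"
  shows "poly_comp V a b"
  using assms unfolding poly_comp_def by meson

lemma poly_comp_cong: "poly_comp V a b \<Longrightarrow> (\<And>i. i \<in> V \<Longrightarrow> b i = b' i) \<Longrightarrow> poly_comp V a b'"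
  unfolding poly_comp_def by (metis (no_types, lifting))

text \<open>Output size is at most input size plus running time. Composition depends on this, as the
  time of the second program is bounded in terms of the intermediate value.\<close>

lemma poly_comp_vsize:
  assumes "poly_comp V a b"
  shows "poly_bounded V (\<lambda>i. vsize (a i)) (\<lambda>i. vsize (b i))"
proof -
  obtain c T where T: "poly_bounded V (\<lambda>i. vsize (a i)) T" and
    c: "\<And>i s. i \<in> V \<Longrightarrow> s 0 = a i \<Longrightarrow> \<exists>t s'. exec c s t s' \<and> t \<le> T i \<and> s' 0 = b i"
    using assms by (rule poly_compE) (rule that)
  have *: "vsize (b i) \<le> vsize (a i) + T i" if i: "i \<in> V" for i
  proof -
    obtain t s' where "exec c (\<lambda>_. a i) t s'" "t \<le> T i" "s' 0 = b i" using c[OF i, of "\<lambda>_. a i"] by blast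
    then show ?thesis using exec_vsize_le[of c _ t s' 0] by fastforce
  qed
  have "poly_bounded V (\<lambda>i. vsize (a i)) (\<lambda>i. vsize (a i) + T i)"
    by (intro poly_bounded_intros T)
  then show ?thesis by (rule poly_bounded_le) (rule *)
qed

lemma poly_comp_refl: "poly_comp V a a"
  by (rule poly_compI[where T = "\<lambda>_. 1" and c = Skip])
    (use exec.Skip in \<open>force intro: poly_bounded_const\<close>)+

lemma poly_comp_trans:
  assumes "poly_comp V a b" "poly_comp V b d"
  shows "poly_comp V a d"
proof -
  obtain c T where T: "poly_bounded V (\<lambda>i. vsize (a i)) T" and
    c: "\<And>i s. i \<in> V \<Longrightarrow> s 0 = a i \<Longrightarrow> \<exists>t s'. exec c s t s' \<and> t \<le> T i \<and> s' 0 = b i"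
    using assms(1) by (rule poly_compE) (rule that)
  obtain c' T' where T': "poly_bounded V (\<lambda>i. vsize (b i)) T'" and
    c': "\<And>i s. i \<in> V \<Longrightarrow> s 0 = b i \<Longrightarrow> \<exists>t s'. exec c' s t s' \<and> t \<le> T' i \<and> s' 0 = d i"
    using assms(2) by (rule poly_compE) (rule that)
  show ?thesis
  proof (rule poly_compI)
    show "poly_bounded V (\<lambda>i. vsize (a i)) (\<lambda>i. 1 + T i + T' i)"
      by (intro poly_bounded_intros T poly_bounded_trans[OF poly_comp_vsize[OF assms(1)] T'])
    fix i and s :: state
    assume i: "i \<in> V" "s 0 = a i"
    obtain t s' where 1: "exec c s t s'" "t \<le> T i" "s' 0 = b i" using c[of i s, OF i] by blast
    obtain t' s'' where 2: "exec c' s' t' s''" "t' \<le> T' i" "s'' 0 = d i"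
      using c'[of i s', OF i(1) 1(3)] by blast
    show "\<exists>t s'. exec (Seq c c') s t s' \<and> t \<le> 1 + T i + T' i \<and> s' 0 = d i"
      using exec.Seq[OF 1(1) 2(1)] 1 2 by (intro exI[of _ "1 + t + t'"] exI[of _ s'']) auto
  qed
qed

lemma poly_comp_reindex:
  assumes "poly_comp V a b" "\<And>j. j \<in> W \<Longrightarrow> g j \<in> V"
  shows "poly_comp W (\<lambda>j. a (g j)) (\<lambda>j. b (g j))"
proof -
  obtain T c where T: "poly_bounded V (\<lambda>i. vsize (a i)) T" and
    c: "\<And>i s. i \<in> V \<Longrightarrow> s 0 = a i \<Longrightarrow> \<exists>t s'. exec c s t s' \<and> t \<le> T i \<and> s' 0 = b i"
    using assms(1) by (rule poly_compE) (rule that)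
  show ?thesis
  proof (rule poly_compI[where c = c])
    show "poly_bounded W (\<lambda>j. vsize (a (g j))) (\<lambda>j. T (g j))"
      using T assms(2) by (rule poly_bounded_reindex)
  qed (use assms(2) c in simp)
qed

text \<open>The index map \<open>g\<close> is never executed; only the encoded argument
  \<open>a (g j)\<close> has to be computed. This is how an oracle or an already compiled function
  is invoked.\<close>

lemma poly_comp_call:
  assumes "poly_comp V a b" "poly_comp W d (\<lambda>j. a (g j))" "\<And>j. j \<in> W \<Longrightarrow> g j \<in> V"
  shows "poly_comp W d (\<lambda>j. b (g j))"
  using assms(2) poly_comp_reindex[OF assms(1,3)] by (rule poly_comp_trans)

section \<open>Closure under expressions, pairs and conditionals\<close>

lemma poly_comp_expr:
  assumes "expr_bound e \<le> 1"
  shows "poly_comp V a (\<lambda>i. eval e (\<lambda>_. a i))"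
proof -
  obtain C where C: "\<And>s. eval_cost e s \<le> C * vsize (s 0)" using eval_cost_linear[OF assms] by blast
  show ?thesis
  proof (rule poly_compI)
    show "poly_bounded V (\<lambda>i. vsize (a i)) (\<lambda>i. 1 + C * vsize (a i))"
      by (intro poly_bounded_intros)
    fix i and s :: state
    assume "i \<in> V" and s: "s 0 = a i"
    have "eval e s = eval e (\<lambda>_. a i)" using eval_agree[of e s "\<lambda>_. a i"] assms s by (metis One_nat_def less_Suc0 less_le_trans)
    then show "\<exists>t s'. exec (Assign 0 e) s t s' \<and> t \<le> 1 + C * vsize (a i) \<and> s' 0 = eval e (\<lambda>_. a i)"
      using exec.Assign[of 0 e s] C[of s] s
      by (intro exI[of _ "1 + eval_cost e s"] exI[of _ "s(0 := eval e s)"]) auto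
  qed
qed

lemma poly_comp_pair:
  assumes "poly_comp V a b" "poly_comp V a d"
  shows "poly_comp V a (\<lambda>i. VPair (b i) (d i))"
proof -
  obtain c T where T: "poly_bounded V (\<lambda>i. vsize (a i)) T" and
    c: "\<And>i s. i \<in> V \<Longrightarrow> s 0 = a i \<Longrightarrow> \<exists>t s'. exec c s t s' \<and> t \<le> T i \<and> s' 0 = b i"
    using assms(1) by (rule poly_compE) (rule that)
  obtain c' T' where T': "poly_bounded V (\<lambda>i. vsize (a i)) T'" and
    c': "\<And>i s. i \<in> V \<Longrightarrow> s 0 = a i \<Longrightarrow> \<exists>t s'. exec c' s t s' \<and> t \<le> T' i \<and> s' 0 = d i"
    using assms(2) by (rule poly_compE) (rule that)
  \<comment> \<open>Both programs leave \<open>K\<close> and \<open>Suc K\<close> alone: the former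
    keeps the input for the second run, the latter the first result. The outer \<open>Suc\<close>
    keeps \<open>K\<close> away from variable \<open>0\<close>.\<close>
  define K where "K = Suc (max (com_bound c) (com_bound c'))"
  define prog where "prog = Seq (Assign K (Var 0)) (Seq c (Seq (Assign (Suc K) (Var 0))
    (Seq (Assign 0 (Var K)) (Seq c' (Assign 0 (MkPair (Var (Suc K)) (Var 0)))))))"
  show ?thesis
  proof (rule poly_compI)
    show "poly_bounded V (\<lambda>i. vsize (a i))
      (\<lambda>i. 10 + T i + T' i + 2 * vsize (a i) + 3 * vsize (b i) + 2 * vsize (d i))"
      by (intro poly_bounded_intros T T' poly_comp_vsize assms)
    fix i and s :: state
    assume i: "i \<in> V" and s: "s 0 = a i"
    let ?s1 = "s(K := a i)"
    have 1: "exec (Assign K (Var 0)) s (1 + vsize (a i)) ?s1"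
      using exec.Assign[of K "Var 0" s] s by simp
    obtain t2 s2 where 2: "exec c ?s1 t2 s2" "t2 \<le> T i" "s2 0 = b i"
      using c[OF i, of ?s1] s by (auto simp: K_def)
    have s2K: "s2 K = a i" using exec_frame[OF 2(1), of K] by (simp add: K_def)
    let ?s3 = "s2(Suc K := b i)"
    have 3: "exec (Assign (Suc K) (Var 0)) s2 (1 + vsize (b i)) ?s3"
      using exec.Assign[of "Suc K" "Var 0" s2] 2 by simp
    let ?s4 = "?s3(0 := a i)"
    have 4: "exec (Assign 0 (Var K)) ?s3 (1 + vsize (a i)) ?s4"
      using exec.Assign[of 0 "Var K" ?s3] s2K by simp
    obtain t5 s5 where 5: "exec c' ?s4 t5 s5" "t5 \<le> T' i" "s5 0 = d i"
      using c'[OF i, of ?s4] by auto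
    have s5K: "s5 (Suc K) = b i" using exec_frame[OF 5(1), of "Suc K"] by (simp add: K_def)
    let ?s6 = "s5(0 := VPair (b i) (d i))"
    have 6: "exec (Assign 0 (MkPair (Var (Suc K)) (Var 0))) s5
      (1 + (Suc (vsize (b i) + vsize (d i)) + vsize (b i) + vsize (d i))) ?s6"
      using exec.Assign[of 0 "MkPair (Var (Suc K)) (Var 0)" s5] s5K 5 by simp
    show "\<exists>t s'. exec prog s t s' \<and>
        t \<le> 10 + T i + T' i + 2 * vsize (a i) + 3 * vsize (b i) + 2 * vsize (d i) \<and>
        s' 0 = VPair (b i) (d i)"
      using exec.Seq[OF 1 exec.Seq[OF 2(1) exec.Seq[OF 3 exec.Seq[OF 4 exec.Seq[OF 5(1) 6]]]]]
      unfolding prog_def by (intro exI conjI, assumption) (use 2(2) 5(2) in simp_all)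
  qed
qed

lemma poly_comp_fst: "poly_comp V a b \<Longrightarrow> poly_comp V a (\<lambda>i. val_fst (b i))"
  using poly_comp_expr[of "Fst (Var 0)" V b] by (auto intro: poly_comp_trans)

lemma poly_comp_snd: "poly_comp V a b \<Longrightarrow> poly_comp V a (\<lambda>i. val_snd (b i))"
  using poly_comp_expr[of "Snd (Var 0)" V b] by (auto intro: poly_comp_trans)

lemma poly_comp_fstD: "poly_comp V a (\<lambda>i. VPair (b i) (d i)) \<Longrightarrow> poly_comp V a b"
  using poly_comp_fst[of V a "\<lambda>i. VPair (b i) (d i)"] by simp

lemma poly_comp_sndD: "poly_comp V a (\<lambda>i. VPair (b i) (d i)) \<Longrightarrow> poly_comp V a d"
  using poly_comp_snd[of V a "\<lambda>i. VPair (b i) (d i)"] by simp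

lemma poly_comp_num: "poly_comp V a (\<lambda>_. VNum n)"
  using poly_comp_expr[of "Lit n" V a] by simp

lemma poly_comp_plus:
  assumes "poly_comp V a (\<lambda>i. VNum (x i))" "poly_comp V a (\<lambda>i. VNum (y i))"
  shows "poly_comp V a (\<lambda>i. VNum (x i + y i))"
  using poly_comp_trans[OF poly_comp_pair[OF assms]
      poly_comp_expr[of "Plus (Fst (Var 0)) (Snd (Var 0))"]] by simp

definition vbool :: "bool \<Rightarrow> val" where
  "vbool P = VNum (if P then 1 else 0)"

lemma vbool_eq_0: "vbool P = VNum 0 \<longleftrightarrow> \<not> P"
  by (simp add: vbool_def)

lemma poly_comp_less:
  assumes "poly_comp V a (\<lambda>i. VNum (x i))" "poly_comp V a (\<lambda>i. VNum (y i))"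
  shows "poly_comp V a (\<lambda>i. vbool (x i < y i))"
  using poly_comp_trans[OF poly_comp_pair[OF assms]
      poly_comp_expr[of "Less (Fst (Var 0)) (Snd (Var 0))"]] by (simp add: vbool_def cong: if_cong)

lemma poly_comp_eq:
  assumes "poly_comp V a b" "poly_comp V a d"
  shows "poly_comp V a (\<lambda>i. vbool (b i = d i))"
  using poly_comp_trans[OF poly_comp_pair[OF assms]
      poly_comp_expr[of "Eq (Fst (Var 0)) (Snd (Var 0))"]] by (simp add: vbool_def cong: if_cong)

lemma poly_comp_eq_num:
  assumes "poly_comp V a (\<lambda>i. VNum (x i))" "poly_comp V a (\<lambda>i. VNum (y i))"
  shows "poly_comp V a (\<lambda>i. vbool (x i = y i))"
  using poly_comp_eq[OF assms] by simp

lemma poly_comp_not: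
  assumes "poly_comp V a (\<lambda>i. vbool (P i))"
  shows "poly_comp V a (\<lambda>i. vbool (\<not> P i))"
  using poly_comp_eq[OF assms poly_comp_num[of V a 0]] by (simp add: vbool_eq_0)

text \<open>Both branches are computed before the test selects one, so neither has to be justified
  under an assumption on \<open>P\<close>. The encoder \<open>f\<close> stands outside the
  conditional to match the shape of fold bodies.\<close>

lemma poly_comp_if:
  assumes "poly_comp V a (\<lambda>i. vbool (P i))" "poly_comp V a (\<lambda>i. f (x i))" "poly_comp V a (\<lambda>i. f (y i))"
  shows "poly_comp V a (\<lambda>i. f (if P i then x i else y i))"
proof -
  let ?b = "\<lambda>i. VPair (vbool (P i)) (VPair (f (x i)) (f (y i)))"
  have "poly_comp V ?b (\<lambda>i. f (if P i then x i else y i))"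
  proof (rule poly_compI)
    show "poly_bounded V (\<lambda>i. vsize (?b i)) (\<lambda>i. 20 + 7 * vsize (?b i))"
      by (intro poly_bounded_intros)
    fix i and s :: state
    assume s: "s 0 = ?b i"
    let ?c1 = "Assign 0 (Fst (Snd (Var 0)))" and ?c2 = "Assign 0 (Snd (Snd (Var 0)))"
    show "\<exists>t s'. exec (If (Fst (Var 0)) ?c1 ?c2) s t s' \<and>
      t \<le> 20 + 7 * vsize (?b i) \<and> s' 0 = f (if P i then x i else y i)"
    proof (cases "P i")
      case True
      then have "eval (Fst (Var 0)) s \<noteq> VNum 0" using s by (simp add: vbool_def)
      note run = exec.IfTrue[OF this exec.Assign[of 0 "Fst (Snd (Var 0))"], of ?c2]
      show ?thesis by (intro exI conjI, rule run) (simp_all add: True s vbool_def floorlog_1)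
    next
      case False
      then have "eval (Fst (Var 0)) s = VNum 0" using s by (simp add: vbool_def)
      note run = exec.IfFalse[OF this exec.Assign[of 0 "Snd (Snd (Var 0))"], of ?c1]
      show ?thesis by (intro exI conjI, rule run) (simp_all add: False s vbool_def floorlog_0)
    qed
  qed
  then show ?thesis by (rule poly_comp_trans[rotated]) (intro poly_comp_pair assms)
qed

lemma poly_comp_conj:
  assumes "poly_comp V a (\<lambda>i. vbool (P i))" "poly_comp V a (\<lambda>i. vbool (Q i))"
  shows "poly_comp V a (\<lambda>i. vbool (P i \<and> Q i))"
proof -
  have "poly_comp V a (\<lambda>i. vbool False)"
    using poly_comp_num[of V a 0] by (simp add: vbool_def)
  with assms have "poly_comp V a (\<lambda>i. vbool (if P i then Q i else False))"
    by (rule poly_comp_if)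
  then show ?thesis by (rule poly_comp_cong) simp
qed

lemma poly_comp_disj:
  assumes "poly_comp V a (\<lambda>i. vbool (P i))" "poly_comp V a (\<lambda>i. vbool (Q i))"
  shows "poly_comp V a (\<lambda>i. vbool (P i \<or> Q i))"
  using poly_comp_not[OF poly_comp_conj[OF assms[THEN poly_comp_not]]] by simp


subsection \<open>Lists\<close>

lemma enc_list_simps:
  "enc_list f [] = VNum 0" "enc_list f (x # xs) = VPair (f x) (enc_list f xs)"
  by (simp_all add: enc_list_def)

lemma enc_list_eq_0: "enc_list f xs = VNum 0 \<longleftrightarrow> xs = []"
  by (cases xs) (simp_all add: enc_list_simps)

lemma val_snd_enc_list: "val_snd (enc_list f xs) = enc_list f (tl xs)"
  by (cases xs) (simp_all add: enc_list_simps)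

lemma vsize_enc_list: "vsize (enc_list f xs) = Suc (\<Sum>x\<leftarrow>xs. Suc (vsize (f x)))"
  by (induction xs) (simp_all add: enc_list_simps floorlog_0)

lemma length_le_vsize: "length xs \<le> vsize (enc_list f xs)"
  by (induction xs) (simp_all add: enc_list_simps)

lemma vsize_le_enc_list: "x \<in> set xs \<Longrightarrow> vsize (f x) \<le> vsize (enc_list f xs)"
  by (induction xs) (auto simp: enc_list_simps)

text \<open>Variable \<open>K\<close> holds the fixed parameter, \<open>K + 1\<close> the rest of
  the list and \<open>K + 2\<close> the accumulator; the body receives parameter, head and
  accumulator packed in variable \<open>0\<close>.\<close>

definition loop :: "nat \<Rightarrow> com \<Rightarrow> com" where
  "loop K c = While (Var (K + 1))
    (Seq (Assign 0 (MkPair (Var K) (MkPair (Fst (Var (K + 1))) (Var (K + 2)))))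
    (Seq c (Seq (Assign (K + 2) (Var 0)) (Assign (K + 1) (Snd (Var (K + 1)))))))"

text \<open>\<open>D\<close> bounds the accumulator after every prefix of the list. A polynomial
  bound on a single round would not suffice, since a constant factor per round already compounds to
  exponential size. Within \<open>E\<close> and \<open>D\<close> the time \<open>T\<close> of a
  round is uniform.\<close>

lemma exec_loop:
  assumes K: "com_bound c \<le> K" "0 < K"
    and body: "\<And>s x y. s 0 = VPair av (VPair (f x) (g y)) \<Longrightarrow> vsize (f x) \<le> E \<Longrightarrow> vsize (g y) \<le> D \<Longrightarrow>
      \<exists>t s'. exec c s t s' \<and> t \<le> T \<and> s' 0 = g (h x y)"
  shows "s K = av \<Longrightarrow> s (K + 1) = enc_list f xs \<Longrightarrow> s (K + 2) = g y \<Longrightarrow>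
    vsize (enc_list f xs) \<le> E \<Longrightarrow>
    (\<And>ys zs. xs = ys @ zs \<Longrightarrow> vsize (g (fold h ys y)) \<le> D) \<Longrightarrow>
    \<exists>t s'. exec (loop K c) s t s' \<and> s' (K + 2) = g (fold h xs y) \<and>
      t \<le> (length xs + 1) * (20 + T + 3 * vsize av + 8 * E + 4 * D)"
proof (induction xs arbitrary: s y)
  case Nil
  have run: "exec (loop K c) s (1 + eval_cost (Var (K + 1)) s) s"
    unfolding loop_def by (rule exec.WhileFalse) (use Nil in \<open>simp add: enc_list_simps\<close>)
  show ?case by (intro exI conjI, rule run) (use Nil in \<open>simp_all add: enc_list_simps floorlog_0\<close>)
next
  case (Cons x xs)
  let ?M = "20 + T + 3 * vsize av + 8 * E + 4 * D"
  have sizes: "Suc (vsize (f x) + vsize (enc_list f xs)) \<le> E"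
    using Cons.prems(4) by (simp add: enc_list_simps)
  have y: "vsize (g y) \<le> D" using Cons.prems(5)[of "[]"] by simp
  have y': "vsize (g (h x y)) \<le> D" using Cons.prems(5)[of "[x]"] by simp
  have test: "eval (Var (K + 1)) s \<noteq> VNum 0" using Cons.prems by (simp add: enc_list_simps)
  let ?s1 = "s(0 := VPair av (VPair (f x) (g y)))"
  let ?e = "MkPair (Var K) (MkPair (Fst (Var (K + 1))) (Var (K + 2)))"
  have 1: "exec (Assign 0 ?e) s (1 + eval_cost ?e s) ?s1"
    using exec.Assign[of 0 ?e s] Cons.prems by (simp add: enc_list_simps)
  have e: "eval_cost ?e s \<le> 2 + 2 * vsize av + 5 * E + 3 * D"
    using Cons.prems(1-3) sizes y by (simp add: enc_list_simps)
  obtain t2 s2 where 2: "exec c ?s1 t2 s2" "t2 \<le> T" "s2 0 = g (h x y)"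
    using body[of ?s1 x y] sizes y by auto
  have fr: "s2 i = s i" if "K \<le> i" for i
    using exec_frame[OF 2(1), of i] that K by simp
  let ?s3 = "s2(K + 2 := g (h x y))"
  have 3: "exec (Assign (K + 2) (Var 0)) s2 (1 + vsize (g (h x y))) ?s3"
    using exec.Assign[of "K + 2" "Var 0" s2] 2 by simp
  let ?s4 = "?s3(K + 1 := enc_list f xs)"
  have 4: "exec (Assign (K + 1) (Snd (Var (K + 1)))) ?s3 (1 + eval_cost (Snd (Var (K + 1))) ?s3) ?s4"
    using exec.Assign[of "K + 1" "Snd (Var (K + 1))" ?s3] fr Cons.prems by (simp add: enc_list_simps)
  have e': "eval_cost (Snd (Var (K + 1))) ?s3 \<le> 2 * E"
    using fr[of "K + 1"] Cons.prems(2) sizes by (simp add: enc_list_simps)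
  have "\<exists>t s'. exec (loop K c) ?s4 t s' \<and> s' (K + 2) = g (fold h xs (h x y)) \<and>
      t \<le> (length xs + 1) * ?M"
  proof (rule Cons.IH)
    show "vsize (g (fold h ys (h x y))) \<le> D" if "xs = ys @ zs" for ys zs
      using Cons.prems(5)[of "x # ys" zs] that by simp
  qed (use fr Cons.prems sizes in simp_all)
  then obtain t5 s5 where 5: "exec (loop K c) ?s4 t5 s5" "s5 (K + 2) = g (fold h (x # xs) y)"
    "t5 \<le> (length xs + 1) * ?M"
    by auto
  have cost: "eval_cost (Var (K + 1)) s \<le> E"
    using Cons.prems(2,4) by simp
  note run = exec.WhileTrue[OF test exec.Seq[OF 1 exec.Seq[OF 2(1) exec.Seq[OF 3 4]]]
      5(1)[unfolded loop_def]]
  show ?case unfolding loop_def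
  proof (intro exI conjI, rule run)
    show "s5 (K + 2) = g (fold h (x # xs) y)" by (rule 5(2))
    have "1 + (1 + eval_cost ?e s) + (1 + t2 + (1 + (1 + vsize (g (h x y))) +
      (1 + eval_cost (Snd (Var (K + 1))) ?s3))) \<le> 15 + T + 2 * vsize av + 7 * E + 4 * D"
      using e e' 2(2) y' by linarith
    then have "1 + eval_cost (Var (K + 1)) s + (1 + (1 + eval_cost ?e s) + (1 + t2 + (1 + (1 + vsize (g (h x y))) +
      (1 + eval_cost (Snd (Var (K + 1))) ?s3)))) + t5 \<le> (1 + E + (15 + T + 2 * vsize av + 7 * E + 4 * D)) + (length xs + 1) * ?M"
      using cost 5(3) by linarith
    also have "\<dots> \<le> (length (x # xs) + 1) * (20 + T + 3 * vsize av + 8 * E + 4 * D)"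
      by simp
    finally show "1 + eval_cost (Var (K + 1)) s + (1 + (1 + eval_cost ?e s) + (1 + t2 + (1 + (1 + vsize (g (h x y))) +
      (1 + eval_cost (Snd (Var (K + 1))) ?s3)))) + t5 \<le> (length (x # xs) + 1) * ?M" .
  qed
qed

text \<open>
  The premise \<open>step\<close> is stated for an arbitrary encoding \<open>d\<close> of the triple of index, list element
  and accumulator, so that the closure rules suffice to prove it.
\<close>

lemma poly_comp_fold:
  assumes xs: "poly_comp V a (\<lambda>i. enc_list f (xs i))"
    and y: "poly_comp V a (\<lambda>i. g (y i))"
    and step: "\<And>d. poly_comp (V \<times> UNIV) d (\<lambda>z. a (fst z)) \<Longrightarrow>
      poly_comp (V \<times> UNIV) d (\<lambda>z. f (fst (snd z))) \<Longrightarrow>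
      poly_comp (V \<times> UNIV) d (\<lambda>z. g (snd (snd z))) \<Longrightarrow>
      poly_comp (V \<times> UNIV) d (\<lambda>z. g (h (fst z) (fst (snd z)) (snd (snd z))))"
    and D: "poly_bounded V (\<lambda>i. vsize (a i)) D"
    and size: "\<And>i us vs. i \<in> V \<Longrightarrow> xs i = us @ vs \<Longrightarrow> vsize (g (fold (h i) us (y i))) \<le> D i"
  shows "poly_comp V a (\<lambda>i. g (fold (h i) (xs i) (y i)))"
proof -
  \<comment> \<open>The concrete packing that the loop body finds in variable \<open>0\<close>; the
    premise \<open>step\<close> is instantiated with it.\<close>
  let ?d = "\<lambda>z. VPair (a (fst z)) (VPair (f (fst (snd z))) (g (snd (snd z))))"
  let ?S = "V \<times> UNIV"
  have d: "poly_comp ?S ?d ?d" by (rule poly_comp_refl)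
  note d1 = poly_comp_fstD[OF d] and d2 = poly_comp_fstD[OF poly_comp_sndD[OF d]]
    and d3 = poly_comp_sndD[OF poly_comp_sndD[OF d]]
  obtain T c where T: "poly_bounded ?S (\<lambda>z. vsize (?d z)) T" and
    c: "\<And>z s. z \<in> ?S \<Longrightarrow> s 0 = ?d z \<Longrightarrow>
      \<exists>t s'. exec c s t s' \<and> t \<le> T z \<and> s' 0 = g (h (fst z) (fst (snd z)) (snd (snd z)))"
    using step[OF d1 d2 d3] by (rule poly_compE) (rule that)
  obtain p where p: "\<And>z. z \<in> ?S \<Longrightarrow> T z \<le> poly p (vsize (?d z))"
    using T unfolding poly_bounded_def by blast
  define E where "E = (\<lambda>i. vsize (enc_list f (xs i)))"
  have E: "poly_bounded V (\<lambda>i. vsize (a i)) E"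
    unfolding E_def by (rule poly_comp_vsize[OF xs])
  \<comment> \<open>One time bound for all rounds, by monotonicity of \<open>p\<close>; the
    \<open>2\<close> counts the two pair constructors of the packing.\<close>
  define T' where "T' = (\<lambda>i. poly p (2 + vsize (a i) + E i + D i))"
  define K where "K = Suc (com_bound c)"
  let ?i = "\<lambda>i. VPair (a i) (VPair (enc_list f (xs i)) (g (y i)))"
  define prog where "prog = Seq (Assign K (Fst (Var 0))) (Seq (Assign (K + 1) (Fst (Snd (Var 0))))
    (Seq (Assign (K + 2) (Snd (Snd (Var 0)))) (Seq (loop K c) (Assign 0 (Var (K + 2))))))"
  define B where "B = (\<lambda>i. 50 + 8 * vsize (?i i) + 4 * vsize (a i) + 3 * E i + 6 * D i
      + (E i + 1) * (20 + T' i + 3 * vsize (a i) + 8 * E i + 4 * D i))"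
  have i: "poly_comp V a ?i" by (intro poly_comp_pair xs y poly_comp_refl)
  have "poly_comp V ?i (\<lambda>i. g (fold (h i) (xs i) (y i)))"
  proof (rule poly_compI)
    have *: "poly_bounded V (\<lambda>i. vsize (a i)) B"
      unfolding B_def T'_def by (intro poly_bounded_intros poly_comp_vsize[OF i] E D)
    \<comment> \<open>The bounds above are relative to \<open>a\<close>, whereas the program starts
      from the packed input, of which \<open>a i\<close> is a component.\<close>
    have "poly_bounded V (\<lambda>i. vsize (?i i)) (\<lambda>i. vsize (a i))"
      by (rule poly_bounded_le[OF poly_bounded_refl]) simp
    then show "poly_bounded V (\<lambda>i. vsize (?i i)) B" using * by (rule poly_bounded_trans)
    fix i and s :: state
    assume i: "i \<in> V" and s: "s 0 = ?i i"
    let ?s1 = "s(K := a i)" let ?s2 = "?s1(K + 1 := enc_list f (xs i))" let ?s3 = "?s2(K + 2 := g (y i))"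
    have 1: "exec (Assign K (Fst (Var 0))) s (1 + eval_cost (Fst (Var 0)) s) ?s1"
      using exec.Assign[of K "Fst (Var 0)" s] s by simp
    have 2: "exec (Assign (K + 1) (Fst (Snd (Var 0)))) ?s1 (1 + eval_cost (Fst (Snd (Var 0))) ?s1) ?s2"
      using exec.Assign[of "K + 1" "Fst (Snd (Var 0))" ?s1] s by (simp add: K_def)
    have 3: "exec (Assign (K + 2) (Snd (Snd (Var 0)))) ?s2 (1 + eval_cost (Snd (Snd (Var 0))) ?s2) ?s3"
      using exec.Assign[of "K + 2" "Snd (Snd (Var 0))" ?s2] s by (simp add: K_def)
    have body: "\<exists>t s'. exec c s t s' \<and> t \<le> T' i \<and> s' 0 = g (h i x y)"
      if "s 0 = VPair (a i) (VPair (f x) (g y))" "vsize (f x) \<le> E i" "vsize (g y) \<le> D i" for s :: state and x y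
    proof -
      have "T (i, x, y) \<le> poly p (vsize (?d (i, x, y)))" using i by (intro p) simp
      also have "\<dots> \<le> T' i" unfolding T'_def using that by (intro poly_mono_nat) simp
      finally show ?thesis using c[of "(i, x, y)" s] i that(1) by fastforce
    qed
    have "\<exists>t s'. exec (loop K c) ?s3 t s' \<and> s' (K + 2) = g (fold (h i) (xs i) (y i)) \<and>
      t \<le> (length (xs i) + 1) * (20 + T' i + 3 * vsize (a i) + 8 * E i + 4 * D i)"
      by (rule exec_loop[where f = f and av = "a i"]) (use body size[OF i] in \<open>simp_all add: K_def E_def\<close>)
    then obtain t4 s4 where 4: "exec (loop K c) ?s3 t4 s4" "s4 (K + 2) = g (fold (h i) (xs i) (y i))"
      "t4 \<le> (length (xs i) + 1) * (20 + T' i + 3 * vsize (a i) + 8 * E i + 4 * D i)" by blast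
    have cost: "t4 \<le> (E i + 1) * (20 + T' i + 3 * vsize (a i) + 8 * E i + 4 * D i)"
      using 4(3) length_le_vsize[of "xs i" f] mult_le_mono1 unfolding E_def
      by (meson add_le_mono1 le_trans)
    have 5: "exec (Assign 0 (Var (K + 2))) s4 (1 + vsize (g (fold (h i) (xs i) (y i))))
      (s4(0 := g (fold (h i) (xs i) (y i))))"
      using exec.Assign[of 0 "Var (K + 2)" s4] 4(2) by simp
    have res: "vsize (g (fold (h i) (xs i) (y i))) \<le> D i" using size[OF i, of "xs i" "[]"] by simp
    have costs: "eval_cost (Fst (Var 0)) s \<le> 2 * vsize (?i i)"
      "eval_cost (Fst (Snd (Var 0))) ?s1 \<le> 3 * vsize (?i i)"
      "eval_cost (Snd (Snd (Var 0))) ?s2 \<le> 3 * vsize (?i i)"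
      using s by (simp_all add: K_def)
    show "\<exists>t s'. exec prog s t s' \<and> t \<le> B i \<and> s' 0 = g (fold (h i) (xs i) (y i))"
      unfolding prog_def
      by (intro exI conjI, rule exec.Seq[OF 1 exec.Seq[OF 2 exec.Seq[OF 3 exec.Seq[OF 4(1) 5]]]])
        (use cost res costs in \<open>simp_all add: B_def del: eval_cost.simps\<close>)
  qed
  with i show ?thesis by (rule poly_comp_trans)
qed

lemma poly_comp_nil: "poly_comp V a (\<lambda>i. enc_list f [])"
  using poly_comp_num[of V a 0] by (simp add: enc_list_simps)

lemma poly_comp_cons:
  assumes "poly_comp V a (\<lambda>i. f (x i))" "poly_comp V a (\<lambda>i. enc_list f (xs i))"
  shows "poly_comp V a (\<lambda>i. enc_list f (x i # xs i))"
  using poly_comp_pair[OF assms] by (simp add: enc_list_simps)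

text \<open>Weakening: what can be computed from the index remains computable when a list element or
  an accumulator is added to it.\<close>

lemma poly_comp_fst_lift:
  assumes "poly_comp V a b" "poly_comp (V \<times> U) d (\<lambda>z. a (fst z))"
  shows "poly_comp (V \<times> U) d (\<lambda>z. b (fst z))"
  by (rule poly_comp_call[OF assms]) auto

lemma fold_Cons: "fold (#) xs ys = rev xs @ ys"
  by (induction xs arbitrary: ys) auto

lemma vsize_enc_list_append_le:
  "vsize (enc_list f (xs @ ys)) \<le> vsize (enc_list f xs) + vsize (enc_list f ys)"
  by (simp add: vsize_enc_list)

lemma vsize_enc_list_rev: "vsize (enc_list f (rev xs)) = vsize (enc_list f xs)"
  by (simp add: vsize_enc_list sum_list_rev flip: rev_map)

lemma vsize_enc_list_le:
  assumes "\<And>x. x \<in> set xs \<Longrightarrow> vsize (f x) \<le> M" "length xs \<le> l"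
  shows "vsize (enc_list f xs) \<le> Suc (l * Suc M)"
proof -
  have "(\<Sum>x\<leftarrow>xs. Suc (vsize (f x))) \<le> length xs * Suc M"
    using assms(1)
  proof (induction xs)
    case (Cons x xs)
    have "vsize (f x) \<le> M" by (rule Cons.prems) simp
    moreover have "(\<Sum>x\<leftarrow>xs. Suc (vsize (f x))) \<le> length xs * Suc M"
      by (rule Cons.IH, rule Cons.prems) simp
    ultimately show ?case by simp
  qed simp
  also have "\<dots> \<le> l * Suc M" using assms(2) by (rule mult_le_mono1)
  finally show ?thesis by (simp add: vsize_enc_list)
qed

lemma floorlog_le_self: "floorlog 2 n \<le> n"
  by (simp add: floorlog_le_iff_less_power)

section \<open>List functions compiled from the fold\<close>

lemma poly_comp_rev_append:
  assumes xs: "poly_comp V a (\<lambda>i. enc_list f (xs i))" and ys: "poly_comp V a (\<lambda>i. enc_list f (ys i))"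
  shows "poly_comp V a (\<lambda>i. enc_list f (rev (xs i) @ ys i))"
proof -
  have "poly_comp V a (\<lambda>i. enc_list f (fold (#) (xs i) (ys i)))"
  proof (rule poly_comp_fold[where g = "enc_list f", OF xs ys])
    show "poly_bounded V (\<lambda>i. vsize (a i)) (\<lambda>i. vsize (enc_list f (xs i)) + vsize (enc_list f (ys i)))"
      by (intro poly_bounded_intros poly_comp_vsize xs ys)
    fix i us vs
    assume "xs i = us @ vs"
    then show "vsize (enc_list f (fold (#) us (ys i))) \<le> vsize (enc_list f (xs i)) + vsize (enc_list f (ys i))"
      by (simp add: fold_Cons vsize_enc_list sum_list_rev flip: rev_map)
  qed (rule poly_comp_cons)
  then show ?thesis by (simp add: fold_Cons)
qed

lemma poly_comp_rev:
  "poly_comp V a (\<lambda>i. enc_list f (xs i)) \<Longrightarrow> poly_comp V a (\<lambda>i. enc_list f (rev (xs i)))"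
  using poly_comp_rev_append[OF _ poly_comp_nil] by fastforce

lemma poly_comp_append:
  assumes "poly_comp V a (\<lambda>i. enc_list f (xs i))" "poly_comp V a (\<lambda>i. enc_list f (ys i))"
  shows "poly_comp V a (\<lambda>i. enc_list f (xs i @ ys i))"
  using poly_comp_rev_append[OF poly_comp_rev[OF assms(1)] assms(2)] by simp

lemma poly_comp_length:
  assumes xs: "poly_comp V a (\<lambda>i. enc_list f (xs i))"
  shows "poly_comp V a (\<lambda>i. VNum (length (xs i)))"
proof -
  have *: "fold (\<lambda>_ n. n + 1) us m = length us + m" for us :: "'b list" and m :: nat
    by (induction us arbitrary: m) auto
  have "poly_comp V a (\<lambda>i. VNum (fold (\<lambda>_ n. n + 1) (xs i) 0))"
  proof (rule poly_comp_fold[where g = VNum, OF xs poly_comp_num])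
    show "poly_bounded V (\<lambda>i. vsize (a i)) (\<lambda>i. 1 + vsize (enc_list f (xs i)))"
      by (intro poly_bounded_intros poly_comp_vsize xs)
    fix i us vs
    assume "xs i = us @ vs"
    then show "vsize (VNum (fold (\<lambda>_ n. n + 1) us 0)) \<le> 1 + vsize (enc_list f (xs i))"
      unfolding * using length_le_vsize[of "xs i" f] floorlog_le_self[of "length us"] by simp
  qed (intro poly_comp_plus poly_comp_num)
  then show ?thesis unfolding * by simp
qed

lemma poly_comp_map:
  assumes xs: "poly_comp V a (\<lambda>i. enc_list f (xs i))"
    and step: "\<And>d. poly_comp (V \<times> UNIV) d (\<lambda>z. a (fst z)) \<Longrightarrow> poly_comp (V \<times> UNIV) d (\<lambda>z. f (snd z)) \<Longrightarrow>
      poly_comp (V \<times> UNIV) d (\<lambda>z. g (e (fst z) (snd z)))"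
  shows "poly_comp V a (\<lambda>i. enc_list g (map (e i) (xs i)))"
proof -
  let ?d = "\<lambda>z. VPair (a (fst z)) (f (snd z))"
  have d: "poly_comp (V \<times> UNIV) ?d ?d" by (rule poly_comp_refl)
  have e: "poly_comp (V \<times> UNIV) ?d (\<lambda>z. g (e (fst z) (snd z)))"
    by (rule step) (rule poly_comp_fstD[OF d] poly_comp_sndD[OF d])+
  \<comment> \<open>A single polynomial for all indices and elements; this uniformity controls the
    size of the whole result list.\<close>
  obtain p where p: "\<And>z. z \<in> V \<times> UNIV \<Longrightarrow> vsize (g (e (fst z) (snd z))) \<le> poly p (vsize (?d z))"
    using poly_comp_vsize[OF e] unfolding poly_bounded_def by blast
  have fold: "fold (\<lambda>x acc. e i x # acc) us ys = rev (map (e i) us) @ ys" for us ys i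
    by (induction us arbitrary: ys) auto
  let ?E = "\<lambda>i. vsize (enc_list f (xs i))"
  have "poly_comp V a (\<lambda>i. enc_list g (fold (\<lambda>x acc. e i x # acc) (xs i) []))"
  proof (rule poly_comp_fold[where g = "enc_list g", OF xs poly_comp_nil])
    show "poly_bounded V (\<lambda>i. vsize (a i)) (\<lambda>i. 1 + ?E i * (1 + poly p (1 + vsize (a i) + ?E i)))"
      by (intro poly_bounded_intros poly_comp_vsize xs)
    fix i us vs
    assume i: "i \<in> V" and split: "xs i = us @ vs"
    have "vsize (g (e i x)) \<le> poly p (1 + vsize (a i) + ?E i)" if "x \<in> set us" for x
    proof -
      have "vsize (g (e i x)) \<le> poly p (vsize (?d (i, x)))" using p[of "(i, x)"] i by simp
      also have "\<dots> \<le> poly p (1 + vsize (a i) + ?E i)"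
        using vsize_le_enc_list[of x "xs i" f] that split by (intro poly_mono_nat) simp
      finally show ?thesis .
    qed
    moreover have "length us \<le> ?E i" using length_le_vsize[of "xs i" f] split by simp
    ultimately have "vsize (enc_list g (map (e i) us)) \<le> Suc (?E i * Suc (poly p (1 + vsize (a i) + ?E i)))"
      by (intro vsize_enc_list_le) auto
    then show "vsize (enc_list g (fold (\<lambda>x acc. e i x # acc) us [])) \<le>
        1 + ?E i * (1 + poly p (1 + vsize (a i) + ?E i))"
      by (simp add: fold vsize_enc_list_rev)
  next
    fix d
    assume d: "poly_comp (V \<times> UNIV) d (\<lambda>z. a (fst z))" "poly_comp (V \<times> UNIV) d (\<lambda>z. f (fst (snd z)))"
      "poly_comp (V \<times> UNIV) d (\<lambda>z. enc_list g (snd (snd z)))"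
    have "poly_comp (V \<times> UNIV) d (\<lambda>z. g (e (fst z) (fst (snd z))))"
      using poly_comp_call[OF e, of "V \<times> UNIV" d "\<lambda>z. (fst z, fst (snd z))"] poly_comp_pair[OF d(1,2)]
      by auto
    then show "poly_comp (V \<times> UNIV) d (\<lambda>z. enc_list g (e (fst z) (fst (snd z)) # snd (snd z)))"
      using d(3) by (rule poly_comp_cons)
  qed
  then have "poly_comp V a (\<lambda>i. enc_list g (rev (rev (map (e i) (xs i)))))"
    unfolding fold append_Nil2 by (rule poly_comp_rev)
  then show ?thesis by simp
qed

lemma poly_comp_filter:
  assumes xs: "poly_comp V a (\<lambda>i. enc_list f (xs i))"
    and step: "\<And>d. poly_comp (V \<times> UNIV) d (\<lambda>z. a (fst z)) \<Longrightarrow> poly_comp (V \<times> UNIV) d (\<lambda>z. f (snd z)) \<Longrightarrow>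
      poly_comp (V \<times> UNIV) d (\<lambda>z. vbool (P (fst z) (snd z)))"
  shows "poly_comp V a (\<lambda>i. enc_list f (filter (P i) (xs i)))"
proof -
  let ?d = "\<lambda>z. VPair (a (fst z)) (f (snd z))"
  have d: "poly_comp (V \<times> UNIV) ?d ?d" by (rule poly_comp_refl)
  have e: "poly_comp (V \<times> UNIV) ?d (\<lambda>z. vbool (P (fst z) (snd z)))"
    by (rule step) (rule poly_comp_fstD[OF d] poly_comp_sndD[OF d])+
  have fold: "fold (\<lambda>x acc. if P i x then x # acc else acc) us ys = rev (filter (P i) us) @ ys" for us ys i
    by (induction us arbitrary: ys) auto
  have "poly_comp V a (\<lambda>i. enc_list f (fold (\<lambda>x acc. if P i x then x # acc else acc) (xs i) []))"
  proof (rule poly_comp_fold[where g = "enc_list f", OF xs poly_comp_nil])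
    show "poly_bounded V (\<lambda>i. vsize (a i)) (\<lambda>i. vsize (enc_list f (xs i)))"
      by (rule poly_comp_vsize[OF xs])
    fix i us vs
    assume split: "xs i = us @ vs"
    have "(\<Sum>x\<leftarrow>filter (P i) us. Suc (vsize (f x))) \<le> (\<Sum>x\<leftarrow>us. Suc (vsize (f x)))"
      by (induction us) auto
    then show "vsize (enc_list f (fold (\<lambda>x acc. if P i x then x # acc else acc) us [])) \<le> vsize (enc_list f (xs i))"
      by (simp add: fold vsize_enc_list_rev split) (simp add: vsize_enc_list)
  next
    fix d
    assume d: "poly_comp (V \<times> UNIV) d (\<lambda>z. a (fst z))" "poly_comp (V \<times> UNIV) d (\<lambda>z. f (fst (snd z)))"
      "poly_comp (V \<times> UNIV) d (\<lambda>z. enc_list f (snd (snd z)))"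
    have "poly_comp (V \<times> UNIV) d (\<lambda>z. vbool (P (fst z) (fst (snd z))))"
      using poly_comp_call[OF e, of "V \<times> UNIV" d "\<lambda>z. (fst z, fst (snd z))"] poly_comp_pair[OF d(1,2)]
      by auto
    then show "poly_comp (V \<times> UNIV) d (\<lambda>z. enc_list f
        (if P (fst z) (fst (snd z)) then fst (snd z) # snd (snd z) else snd (snd z)))"
      using poly_comp_cons[OF d(2,3)] d(3) by (rule poly_comp_if)
  qed
  then have "poly_comp V a (\<lambda>i. enc_list f (rev (rev (filter (P i) (xs i)))))"
    unfolding fold append_Nil2 by (rule poly_comp_rev)
  then show ?thesis by simp
qed

lemma poly_comp_nonempty:
  "poly_comp V a (\<lambda>i. enc_list f (xs i)) \<Longrightarrow> poly_comp V a (\<lambda>i. vbool (xs i \<noteq> []))"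
  using poly_comp_not[OF poly_comp_eq[OF _ poly_comp_num]] unfolding enc_list_eq_0[symmetric, of _ f] by auto

lemma poly_comp_mem:
  assumes x: "poly_comp V a (\<lambda>i. VNum (x i))" and xs: "poly_comp V a (\<lambda>i. enc_list VNum (xs i))"
  shows "poly_comp V a (\<lambda>i. vbool (x i \<in> set (xs i)))"
proof -
  have "poly_comp V a (\<lambda>i. vbool (filter (\<lambda>y. y = x i) (xs i) \<noteq> []))"
    by (rule poly_comp_nonempty, rule poly_comp_filter[OF xs], rule poly_comp_eq_num, assumption)
      (rule poly_comp_fst_lift[OF x])
  then show ?thesis by (rule poly_comp_cong) (auto simp: filter_empty_conv)
qed

definition enc_prod :: "('a \<Rightarrow> val) \<Rightarrow> ('b \<Rightarrow> val) \<Rightarrow> 'a \<times> 'b \<Rightarrow> val" where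
  "enc_prod f g p = VPair (f (fst p)) (g (snd p))"

lemma poly_comp_prodD:
  assumes "poly_comp V a (\<lambda>i. enc_prod f g (p i))"
  shows "poly_comp V a (\<lambda>i. f (fst (p i)))" "poly_comp V a (\<lambda>i. g (snd (p i)))"
  using assms unfolding enc_prod_def by (rule poly_comp_fstD, rule poly_comp_sndD)

text \<open>The length of the accumulator is the running counter, so the fold needs no second
  component for it.\<close>

lemma fold_enumerate: "fold (\<lambda>x acc. (length acc, x) # acc) xs [] = rev (List.enumerate 0 xs)"
proof -
  have "fold (\<lambda>x acc. (length acc, x) # acc) xs ys = rev (List.enumerate (length ys) xs) @ ys" for ys
    by (induction xs arbitrary: ys) auto
  then show ?thesis by simp
qed

lemma poly_comp_enumerate:
  assumes xs: "poly_comp V a (\<lambda>i. enc_list f (xs i))"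
  shows "poly_comp V a (\<lambda>i. enc_list (enc_prod VNum f) (List.enumerate 0 (xs i)))"
proof -
  let ?E = "\<lambda>i. vsize (enc_list f (xs i))"
  have "poly_comp V a (\<lambda>i. enc_list (enc_prod VNum f) (fold (\<lambda>x acc. (length acc, x) # acc) (xs i) []))"
  proof (rule poly_comp_fold[where g = "enc_list (enc_prod VNum f)", OF xs poly_comp_nil])
    show "poly_bounded V (\<lambda>i. vsize (a i)) (\<lambda>i. 1 + ?E i * (1 + (2 + ?E i + ?E i)))"
      by (intro poly_bounded_intros poly_comp_vsize xs)
    fix i us vs
    assume split: "xs i = us @ vs"
    have l: "length us \<le> ?E i" using length_le_vsize[of "xs i" f] split by simp
    have "vsize (enc_prod VNum f p) \<le> 2 + ?E i + ?E i" if "p \<in> set (List.enumerate 0 us)" for p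
    proof -
      obtain n x where p: "p = (n, x)" by fastforce
      with that have n: "n < length us" "x \<in> set us" by (auto simp: in_set_enumerate_eq)
      then have "vsize (f x) \<le> ?E i" using split by (intro vsize_le_enc_list) simp
      then show ?thesis using p n l floorlog_le_self[of n] by (simp add: enc_prod_def)
    qed
    with l have "vsize (enc_list (enc_prod VNum f) (List.enumerate 0 us)) \<le> Suc (?E i * Suc (2 + ?E i + ?E i))"
      by (intro vsize_enc_list_le) auto
    then show "vsize (enc_list (enc_prod VNum f) (fold (\<lambda>x acc. (length acc, x) # acc) us []))
        \<le> 1 + ?E i * (1 + (2 + ?E i + ?E i))"
      by (simp add: fold_enumerate vsize_enc_list_rev)
  next
    fix d
    assume d: "poly_comp (V \<times> UNIV) d (\<lambda>z. a (fst z))" "poly_comp (V \<times> UNIV) d (\<lambda>z. f (fst (snd z)))"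
      "poly_comp (V \<times> UNIV) d (\<lambda>z. enc_list (enc_prod VNum f) (snd (snd z)))"
    have "poly_comp (V \<times> UNIV) d (\<lambda>z. enc_prod VNum f (length (snd (snd z)), fst (snd z)))"
      unfolding enc_prod_def fst_conv snd_conv[of _ "fst (snd _)"]
      by (intro poly_comp_pair poly_comp_length[OF d(3)] d(2))
    then show "poly_comp (V \<times> UNIV) d
        (\<lambda>z. enc_list (enc_prod VNum f) ((length (snd (snd z)), fst (snd z)) # snd (snd z)))"
      using d(3) by (rule poly_comp_cons)
  qed
  then show ?thesis unfolding fold_enumerate by (drule_tac poly_comp_rev) simp
qed

text \<open>A list stands in for a unary number: counting up to a number given in binary may take
  exponential time, whereas the length of a list is at most its size.\<close>

lemma poly_comp_upt:
  assumes xs: "poly_comp V a (\<lambda>i. enc_list f (xs i))"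
  shows "poly_comp V a (\<lambda>i. enc_list VNum [0..<length (xs i)])"
proof -
  have "poly_comp V a (\<lambda>i. enc_list VNum (map fst (List.enumerate 0 (xs i))))"
    by (rule poly_comp_map[OF poly_comp_enumerate[OF xs]]) (rule poly_comp_prodD(1))
  then show ?thesis by simp
qed

text \<open>Multiplication in unary, by appending \<open>ys i\<close> once per element of
  \<open>xs i\<close>. It produces the list of the \<open>n * n\<close> vertices of the interdiction
  instance.\<close>

lemma poly_comp_upt_mult:
  assumes xs: "poly_comp V a (\<lambda>i. enc_list f (xs i))" and ys: "poly_comp V a (\<lambda>i. enc_list f (ys i))"
  shows "poly_comp V a (\<lambda>i. enc_list VNum [0..<length (xs i) * length (ys i)])"
proof -
  let ?h = "\<lambda>i x acc. ys i @ acc"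
  have len: "length (fold (?h i) us acc) = length us * length (ys i) + length acc" for i us acc
    by (induction us arbitrary: acc) auto
  have "poly_comp V a (\<lambda>i. enc_list f (fold (?h i) (xs i) []))"
  proof (rule poly_comp_fold[where g = "enc_list f", OF xs poly_comp_nil])
    show "poly_bounded V (\<lambda>i. vsize (a i)) (\<lambda>i. 1 + vsize (enc_list f (xs i)) * vsize (enc_list f (ys i)))"
      by (intro poly_bounded_intros poly_comp_vsize xs ys)
    fix i us vs
    assume split: "xs i = us @ vs"
    have "vsize (enc_list f (fold (?h i) us acc)) \<le> vsize (enc_list f acc) + length us * vsize (enc_list f (ys i))" for acc
    proof (induction us arbitrary: acc)
      case (Cons u us)
      show ?case
        using Cons[of "ys i @ acc"] vsize_enc_list_append_le[of f "ys i" acc] by simp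
    qed simp
    from this[of "[]"] have "vsize (enc_list f (fold (?h i) us [])) \<le> 1 + length us * vsize (enc_list f (ys i))"
      by (simp add: enc_list_simps floorlog_0)
    also have "\<dots> \<le> 1 + vsize (enc_list f (xs i)) * vsize (enc_list f (ys i))"
      using length_le_vsize[of "xs i" f] split by simp
    finally show "vsize (enc_list f (fold (?h i) us [])) \<le> 1 + vsize (enc_list f (xs i)) * vsize (enc_list f (ys i))" .
  qed (intro poly_comp_append poly_comp_fst_lift[OF ys], assumption+)
  from poly_comp_upt[OF this] show ?thesis by (simp add: len)
qed

subsection \<open>Algorithms as oracles\<close>

primrec clear :: "nat \<Rightarrow> com" where
  "clear 0 = Skip"
| "clear (Suc n) = Seq (Assign (Suc n) (Lit 0)) (clear n)"

lemma exec_clear: "exec (clear n) s (1 + 3 * n) (\<lambda>x. if 0 < x \<and> x \<le> n then VNum 0 else s x)"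
proof (induction n arbitrary: s)
  case 0
  have "(\<lambda>x. if 0 < x \<and> x \<le> 0 then VNum 0 else s x) = s" by auto
  then show ?case using exec.Skip[of s] by simp
next
  case (Suc n)
  have "exec (Assign (Suc n) (Lit 0)) s 2 (s(Suc n := VNum 0))"
    using exec.Assign[of "Suc n" "Lit 0" s] by (simp add: floorlog_0 flip: numeral_2_eq_2)
  from exec.Seq[OF this Suc[of "s(Suc n := VNum 0)"]]
  have "exec (clear (Suc n)) s (1 + 3 * Suc n)
    (\<lambda>x. if 0 < x \<and> x \<le> n then VNum 0 else (s(Suc n := VNum 0)) x)" by (simp add: numeral_2_eq_2 numeral_3_eq_3)
  moreover have "(\<lambda>x. if 0 < x \<and> x \<le> n then VNum 0 else (s(Suc n := VNum 0)) x) =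
    (\<lambda>x. if 0 < x \<and> x \<le> Suc n then VNum 0 else s x)" by (auto simp: le_Suc_eq)
  ultimately show ?case by simp
qed

text \<open>An algorithm is specified only from \<open>input_state\<close>, so the variables it uses
  are zeroed before the call; by \<open>exec_agree\<close> the others may hold saved data. Choice
  collects its outputs on valid instances into the function \<open>r\<close>.\<close>

lemma poly_comp_algorithm:
  assumes "poly_time_algorithm valid enc good c"
  obtains r where "poly_comp {x. valid x} enc r" "\<And>x. valid x \<Longrightarrow> good x (r x)"
proof -
  obtain p :: "nat poly" where "\<forall>x. \<exists>t s. valid x \<longrightarrow>
      exec c (input_state (enc x)) t s \<and> t \<le> poly p (vsize (enc x)) \<and> good x (s 0)"
    using assms unfolding poly_time_algorithm_def by blast
  then obtain t s where ts: "\<And>x. valid x \<Longrightarrow>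
      exec c (input_state (enc x)) (t x) (s x) \<and> t x \<le> poly p (vsize (enc x)) \<and> good x (s x 0)"
    by metis
  \<comment> \<open>\<open>Suc\<close> puts variable \<open>0\<close> among those on which the two
    runs agree, even for a program that mentions no variable.\<close>
  let ?m = "Suc (com_bound c)"
  let ?T = "\<lambda>x. 1 + (1 + 3 * ?m) + poly p (vsize (enc x))"
  have "poly_comp {x. valid x} enc (\<lambda>x. s x 0)"
  proof (rule poly_compI)
    show "poly_bounded {x. valid x} (\<lambda>x. vsize (enc x)) ?T" by (intro poly_bounded_intros)
    fix x and r :: state
    assume x: "x \<in> {x. valid x}" and r: "r 0 = enc x"
    let ?r1 = "\<lambda>i. if 0 < i \<and> i \<le> ?m then VNum 0 else r i"
    have "exec c (input_state (enc x)) (t x) (s x)" using ts x by simp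
    moreover have "\<forall>i<?m. ?r1 i = input_state (enc x) i" using r by (auto simp: input_state_def)
    ultimately obtain r2 where r2: "exec c ?r1 (t x) r2" "\<forall>i<?m. r2 i = s x i"
      using exec_agree[of c "input_state (enc x)" "t x" "s x" ?m ?r1] by auto
    have "t x \<le> poly p (vsize (enc x))" using ts x by simp
    then show "\<exists>t s'. exec (Seq (clear ?m) c) r t s' \<and> t \<le> ?T x \<and> s' 0 = s x 0"
      using exec.Seq[OF exec_clear r2(1)] r2(2)
      by (intro exI[of _ "1 + (1 + 3 * ?m) + t x"] exI[of _ r2]) auto
  qed
  then show ?thesis using that ts by blast
qed

lemma algorithm_poly_comp:
  assumes "poly_comp {x. valid x} enc r" "\<And>x. valid x \<Longrightarrow> good x (r x)"
  shows "\<exists>c. poly_time_algorithm valid enc good c"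
proof -
  obtain T c where T: "poly_bounded {x. valid x} (\<lambda>x. vsize (enc x)) T" and
    c: "\<And>x s. x \<in> {x. valid x} \<Longrightarrow> s 0 = enc x \<Longrightarrow> \<exists>t s'. exec c s t s' \<and> t \<le> T x \<and> s' 0 = r x"
    using assms(1) by (rule poly_compE) (rule that)
  obtain p where p: "\<And>x. valid x \<Longrightarrow> T x \<le> poly p (vsize (enc x))"
    using T unfolding poly_bounded_def by blast
  have "\<exists>t s. exec c (input_state (enc x)) t s \<and> t \<le> poly p (vsize (enc x)) \<and> good x (s 0)"
    if x: "valid x" for x
    using c[of x "input_state (enc x)"] x p[OF x] assms(2)[OF x] le_trans
    by (fastforce simp: input_state_def)
  then show ?thesis unfolding poly_time_algorithm_def by blast
qed

section \<open>The algorithm\<close>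

subsection \<open>Vertex sets of prescribed size\<close>

type_synonym edges = "(nat \<times> nat) list"

definition edge_count :: "edges \<Rightarrow> nat list \<Rightarrow> nat" where
  "edge_count es W = length (filter (\<lambda>e. fst e \<in> set W \<and> snd e \<in> set W) es)"

definition densest_of :: "edges \<Rightarrow> nat list list \<Rightarrow> nat list \<Rightarrow> nat list" where
  "densest_of es = fold (\<lambda>c W. if edge_count es W < edge_count es c then c else W)"

text \<open>For nonempty \<open>W\<close> the default \<open>tl W\<close> also has one vertex less,
  so the length of the result is the same whichever candidate wins.\<close>

definition drop_vertex :: "edges \<Rightarrow> nat list \<Rightarrow> nat list" where
  "drop_vertex es W = densest_of es (map (\<lambda>v. filter (\<lambda>w. w \<noteq> v) W) W) (tl W)"

text \<open>The list is a clock: folds are the form of iteration known to be computable, so the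
  number of rounds is given by a list long enough to reach size \<open>k\<close>.\<close>

definition shrink :: "nat \<Rightarrow> edges \<Rightarrow> nat list \<Rightarrow> nat list \<Rightarrow> nat list" where
  "shrink k es = fold (\<lambda>_ W. if k < length W then drop_vertex es W else W)"

definition pad :: "nat \<Rightarrow> nat list \<Rightarrow> nat list \<Rightarrow> nat list" where
  "pad k = fold (\<lambda>v W. if length W < k \<and> v \<notin> set W then v # W else W)"

lemma densest_of_cases: "densest_of es cs W = W \<or> densest_of es cs W \<in> set cs"
  unfolding densest_of_def by (induction cs arbitrary: W) auto

lemma vsize_filter_le: "vsize (enc_list f (filter P xs)) \<le> vsize (enc_list f xs)"
  unfolding vsize_enc_list by (induction xs) auto

lemma vsize_tl_le: "vsize (enc_list f (tl xs)) \<le> vsize (enc_list f xs)"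
  by (cases xs) (simp_all add: vsize_enc_list)

lemma vsize_drop_vertex: "vsize (enc_list VNum (drop_vertex es W)) \<le> vsize (enc_list VNum W)"
  using densest_of_cases[of es "map (\<lambda>v. filter (\<lambda>w. w \<noteq> v) W) W" "tl W"]
  by (auto simp: drop_vertex_def vsize_filter_le vsize_tl_le)

text \<open>Supplies the accumulator bound that \<open>poly_comp_fold\<close> demands; it holds for
  every clock list, hence for every prefix of one.\<close>

lemma vsize_shrink: "vsize (enc_list VNum (shrink k es vs W)) \<le> vsize (enc_list VNum W)"
  unfolding shrink_def by (induction vs arbitrary: W) (auto intro: order_trans vsize_drop_vertex)

lemma vsize_pad:
  "vsize (enc_list VNum (pad k vs W)) \<le> vsize (enc_list VNum W) + vsize (enc_list VNum vs)"
proof (induction vs arbitrary: W)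
  case (Cons v vs)
  show ?case using Cons[of W] Cons[of "v # W"] by (auto simp: pad_def vsize_enc_list)
qed (simp add: pad_def)

lemma poly_comp_dks_edgeD:
  assumes "poly_comp V a (\<lambda>i. enc_dks_edge (e i))"
  shows "poly_comp V a (\<lambda>i. VNum (fst (e i)))" "poly_comp V a (\<lambda>i. VNum (snd (e i)))"
  using assms unfolding enc_dks_edge_def by (rule poly_comp_fstD, rule poly_comp_sndD)

lemma poly_comp_edge_count:
  assumes es: "poly_comp V a (\<lambda>i. enc_list enc_dks_edge (es i))"
    and W: "poly_comp V a (\<lambda>i. enc_list VNum (W i))"
  shows "poly_comp V a (\<lambda>i. VNum (edge_count (es i) (W i)))"
  unfolding edge_count_def
proof (rule poly_comp_length, rule poly_comp_filter[OF es])
  fix d assume d: "poly_comp (V \<times> UNIV) d (\<lambda>z. a (fst z))" "poly_comp (V \<times> UNIV) d (\<lambda>z. enc_dks_edge (snd z))"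
  show "poly_comp (V \<times> UNIV) d
      (\<lambda>z. vbool (fst (snd z) \<in> set (W (fst z)) \<and> snd (snd z) \<in> set (W (fst z))))"
    by (intro poly_comp_conj poly_comp_mem poly_comp_dks_edgeD[OF d(2)] poly_comp_fst_lift[OF W d(1)])
qed

lemma poly_comp_densest_of:
  assumes es: "poly_comp V a (\<lambda>i. enc_list enc_dks_edge (es i))"
    and cs: "poly_comp V a (\<lambda>i. enc_list (enc_list VNum) (cs i))"
    and W: "poly_comp V a (\<lambda>i. enc_list VNum (W i))"
  shows "poly_comp V a (\<lambda>i. enc_list VNum (densest_of (es i) (cs i) (W i)))"
  unfolding densest_of_def
proof (rule poly_comp_fold[where g = "enc_list VNum", OF cs W])
  show "poly_bounded V (\<lambda>i. vsize (a i))
      (\<lambda>i. vsize (enc_list VNum (W i)) + vsize (enc_list (enc_list VNum) (cs i)))"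
    by (intro poly_bounded_intros poly_comp_vsize W cs)
  fix i us vs
  assume split: "cs i = us @ vs"
  have "vsize (enc_list VNum (densest_of (es i) us (W i))) \<le>
      vsize (enc_list VNum (W i)) + vsize (enc_list (enc_list VNum) (cs i))"
    using densest_of_cases[of "es i" us "W i"]
  proof
    assume "densest_of (es i) us (W i) \<in> set us"
    then show ?thesis using split
      by (intro trans_le_add2 vsize_le_enc_list[of _ _ "enc_list VNum"]) simp
  qed simp
  then show "vsize (enc_list VNum (fold (\<lambda>c W. if edge_count (es i) W < edge_count (es i) c then c else W) us (W i)))
      \<le> vsize (enc_list VNum (W i)) + vsize (enc_list (enc_list VNum) (cs i))"
    unfolding densest_of_def .
next
  fix d
  assume d: "poly_comp (V \<times> UNIV) d (\<lambda>z. a (fst z))" "poly_comp (V \<times> UNIV) d (\<lambda>z. enc_list VNum (fst (snd z)))"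
    "poly_comp (V \<times> UNIV) d (\<lambda>z. enc_list VNum (snd (snd z)))"
  show "poly_comp (V \<times> UNIV) d (\<lambda>z. enc_list VNum
    (if edge_count (es (fst z)) (snd (snd z)) < edge_count (es (fst z)) (fst (snd z)) then fst (snd z) else snd (snd z)))"
    by (rule poly_comp_if[OF poly_comp_less[OF poly_comp_edge_count poly_comp_edge_count]])
      (rule d poly_comp_fst_lift[OF es])+
qed

lemma poly_comp_drop_vertex:
  assumes es: "poly_comp V a (\<lambda>i. enc_list enc_dks_edge (es i))"
    and W: "poly_comp V a (\<lambda>i. enc_list VNum (W i))"
  shows "poly_comp V a (\<lambda>i. enc_list VNum (drop_vertex (es i) (W i)))"
  unfolding drop_vertex_def
proof (rule poly_comp_densest_of[OF es])
  show "poly_comp V a (\<lambda>i. enc_list (enc_list VNum) (map (\<lambda>v. filter (\<lambda>w. w \<noteq> v) (W i)) (W i)))"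
  proof (rule poly_comp_map[OF W])
    fix d assume d: "poly_comp (V \<times> UNIV) d (\<lambda>z. a (fst z))" "poly_comp (V \<times> UNIV) d (\<lambda>z. VNum (snd z))"
    show "poly_comp (V \<times> UNIV) d (\<lambda>z. enc_list VNum (filter (\<lambda>w. w \<noteq> snd z) (W (fst z))))"
      by (rule poly_comp_filter[OF poly_comp_fst_lift[OF W d(1)]], rule poly_comp_not, rule poly_comp_eq_num,
          assumption) (rule poly_comp_fst_lift[OF d(2)])
  qed
  show "poly_comp V a (\<lambda>i. enc_list VNum (tl (W i)))"
    using poly_comp_snd[OF W] by (simp add: val_snd_enc_list)
qed

lemma poly_comp_shrink:
  assumes k: "poly_comp V a (\<lambda>i. VNum (k i))"
    and es: "poly_comp V a (\<lambda>i. enc_list enc_dks_edge (es i))"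
    and vs: "poly_comp V a (\<lambda>i. enc_list VNum (vs i))"
    and W: "poly_comp V a (\<lambda>i. enc_list VNum (W i))"
  shows "poly_comp V a (\<lambda>i. enc_list VNum (shrink (k i) (es i) (vs i) (W i)))"
  unfolding shrink_def
proof (rule poly_comp_fold[where g = "enc_list VNum", OF vs W])
  show "poly_bounded V (\<lambda>i. vsize (a i)) (\<lambda>i. vsize (enc_list VNum (W i)))"
    by (rule poly_comp_vsize[OF W])
  show "vsize (enc_list VNum (fold (\<lambda>_ W. if k i < length W then drop_vertex (es i) W else W) us (W i))) \<le>
      vsize (enc_list VNum (W i))" for i and us :: "nat list"
    using vsize_shrink[of "k i" "es i" us "W i"] by (simp add: shrink_def)
next
  fix d
  assume d: "poly_comp (V \<times> UNIV) d (\<lambda>z. a (fst z))" "poly_comp (V \<times> UNIV) d (\<lambda>z. VNum (fst (snd z)))"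
    "poly_comp (V \<times> UNIV) d (\<lambda>z. enc_list VNum (snd (snd z)))"
  show "poly_comp (V \<times> UNIV) d (\<lambda>z. enc_list VNum
      (if k (fst z) < length (snd (snd z)) then drop_vertex (es (fst z)) (snd (snd z)) else snd (snd z)))"
    by (rule poly_comp_if[OF poly_comp_less[OF _ poly_comp_length[OF d(3)]]])
      (rule d(3) poly_comp_drop_vertex poly_comp_fst_lift[OF k d(1)] poly_comp_fst_lift[OF es d(1)])+
qed

lemma poly_comp_pad:
  assumes k: "poly_comp V a (\<lambda>i. VNum (k i))"
    and vs: "poly_comp V a (\<lambda>i. enc_list VNum (vs i))"
    and W: "poly_comp V a (\<lambda>i. enc_list VNum (W i))"
  shows "poly_comp V a (\<lambda>i. enc_list VNum (pad (k i) (vs i) (W i)))"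
  unfolding pad_def
proof (rule poly_comp_fold[where g = "enc_list VNum", OF vs W])
  show "poly_bounded V (\<lambda>i. vsize (a i)) (\<lambda>i. vsize (enc_list VNum (W i)) + vsize (enc_list VNum (vs i)))"
    by (intro poly_bounded_intros poly_comp_vsize W vs)
  fix i us zs
  assume "vs i = us @ zs"
  then have "vsize (enc_list VNum us) \<le> vsize (enc_list VNum (vs i))" by (simp add: vsize_enc_list)
  then show "vsize (enc_list VNum (fold (\<lambda>v W. if length W < k i \<and> v \<notin> set W then v # W else W) us (W i))) \<le>
      vsize (enc_list VNum (W i)) + vsize (enc_list VNum (vs i))"
    using vsize_pad[of "k i" us "W i"] unfolding pad_def by linarith
next
  fix d
  assume d: "poly_comp (V \<times> UNIV) d (\<lambda>z. a (fst z))" "poly_comp (V \<times> UNIV) d (\<lambda>z. VNum (fst (snd z)))"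
    "poly_comp (V \<times> UNIV) d (\<lambda>z. enc_list VNum (snd (snd z)))"
  show "poly_comp (V \<times> UNIV) d (\<lambda>z. enc_list VNum
      (if length (snd (snd z)) < k (fst z) \<and> fst (snd z) \<notin> set (snd (snd z))
       then fst (snd z) # snd (snd z) else snd (snd z)))"
    by (rule poly_comp_if[OF poly_comp_conj[OF poly_comp_less[OF poly_comp_length[OF d(3)]]
          poly_comp_not[OF poly_comp_mem[OF d(2,3)]]]])
      (rule d poly_comp_cons poly_comp_fst_lift[OF k])+
qed

subsection \<open>The interdiction instance\<close>

text \<open>
  An edge \<open>uw\<close> of \<open>H\<close> becomes a triangle on \<open>u\<close>, \<open>w\<close> and the sink \<open>n + 1\<close>, with edges of cost \<open>1\<close>;
  the edges at the source \<open>n\<close> exceed the budget. The isolated vertices above \<open>n + 1\<close> make the number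
  of vertices exactly \<open>n\<^sup>2\<close>, which matters because \<open>\<alpha>\<close> need not be monotone.
\<close>

definition nfi_edge_of :: "nat \<Rightarrow> nat \<Rightarrow> nat \<Rightarrow> nat \<Rightarrow> nfi_edge" where
  "nfi_edge_of u v q w = \<lparr>end1 = u, end2 = v, capacity = q, cost = w\<rparr>"

lemma nfi_edge_of_simps [simp]:
  "end1 (nfi_edge_of u v q w) = u" "end2 (nfi_edge_of u v q w) = v"
  "capacity (nfi_edge_of u v q w) = q" "cost (nfi_edge_of u v q w) = w"
  by (simp_all add: nfi_edge_of_def)

definition interdiction_edges :: "nat \<Rightarrow> edges \<Rightarrow> nat \<Rightarrow> nfi_edge list" where
  "interdiction_edges n es b =
    map (\<lambda>e. nfi_edge_of (fst e) (snd e) 2 1) es @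
    map (\<lambda>e. nfi_edge_of (fst e) (n + 1) 2 1) es @
    map (\<lambda>e. nfi_edge_of (snd e) (n + 1) 2 1) es @
    map (\<lambda>v. nfi_edge_of n v 1 (b + 1)) [0..<n]"

definition interdiction :: "dks \<Rightarrow> nat \<Rightarrow> nfi" where
  "interdiction H b = \<lparr>nfi_n = dks_n H * dks_n H, nfi_source = dks_n H, nfi_sink = dks_n H + 1,
    nfi_edges = interdiction_edges (dks_n H) (dks_edges H) b, nfi_budget = b\<rparr>"

lemma poly_comp_dksD:
  assumes "poly_comp V a (\<lambda>i. enc_dks (H i))"
  shows "poly_comp V a (\<lambda>i. enc_list VNum [0..<dks_n (H i)])"
    "poly_comp V a (\<lambda>i. enc_list enc_dks_edge (dks_edges (H i)))"
    "poly_comp V a (\<lambda>i. VNum (dks_k (H i)))"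
    "poly_comp V a (\<lambda>i. VNum (dks_n (H i)))"
proof -
  note d = assms[unfolded enc_dks_def]
  show 1: "poly_comp V a (\<lambda>i. enc_list VNum [0..<dks_n (H i)])" by (rule poly_comp_fstD[OF d])
  show "poly_comp V a (\<lambda>i. enc_list enc_dks_edge (dks_edges (H i)))"
    by (rule poly_comp_fstD[OF poly_comp_sndD[OF d]])
  show "poly_comp V a (\<lambda>i. VNum (dks_k (H i)))"
    by (rule poly_comp_sndD[OF poly_comp_sndD[OF d]])
  show "poly_comp V a (\<lambda>i. VNum (dks_n (H i)))"
    using poly_comp_length[OF 1] by simp
qed

lemma poly_comp_nfi_edge_of:
  assumes "poly_comp V a (\<lambda>i. VNum (u i))" "poly_comp V a (\<lambda>i. VNum (v i))"
    "poly_comp V a (\<lambda>i. VNum (q i))" "poly_comp V a (\<lambda>i. VNum (w i))"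
  shows "poly_comp V a (\<lambda>i. enc_nfi_edge (nfi_edge_of (u i) (v i) (q i) (w i)))"
  unfolding enc_nfi_edge_def nfi_edge_of_simps by (intro poly_comp_pair assms)

lemma poly_comp_interdiction_edges:
  assumes vs: "poly_comp V a (\<lambda>i. enc_list VNum [0..<n i])"
    and es: "poly_comp V a (\<lambda>i. enc_list enc_dks_edge (es i))"
    and b: "poly_comp V a (\<lambda>i. VNum (b i))"
  shows "poly_comp V a (\<lambda>i. enc_list enc_nfi_edge (interdiction_edges (n i) (es i) (b i)))"
proof -
  have n: "poly_comp V a (\<lambda>i. VNum (n i))" using poly_comp_length[OF vs] by simp
  have t: "poly_comp V a (\<lambda>i. VNum (n i + 1))" and b': "poly_comp V a (\<lambda>i. VNum (b i + 1))"
    by (intro poly_comp_plus n b poly_comp_num)+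
  show ?thesis
    unfolding interdiction_edges_def
    apply (intro poly_comp_append)
       apply (rule poly_comp_map[OF es], (rule poly_comp_nfi_edge_of poly_comp_num poly_comp_dks_edgeD | assumption)+)
      apply (rule poly_comp_map[OF es], (rule poly_comp_nfi_edge_of poly_comp_num poly_comp_dks_edgeD
          poly_comp_fst_lift[OF t] | assumption)+)
     apply (rule poly_comp_map[OF es], (rule poly_comp_nfi_edge_of poly_comp_num poly_comp_dks_edgeD
          poly_comp_fst_lift[OF t] | assumption)+)
    apply (rule poly_comp_map[OF vs], (rule poly_comp_nfi_edge_of poly_comp_num
          poly_comp_fst_lift[OF n] poly_comp_fst_lift[OF b'] | assumption)+)
    done
qed

lemma poly_comp_interdiction:
  assumes H: "poly_comp V a (\<lambda>i. enc_dks (H i))" and b: "poly_comp V a (\<lambda>i. VNum (b i))"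
  shows "poly_comp V a (\<lambda>i. enc_nfi (interdiction (H i) (b i)))"
proof -
  note h = poly_comp_dksD[OF H]
  have "poly_comp V a (\<lambda>i. enc_list VNum [0..<dks_n (H i) * dks_n (H i)])"
    using poly_comp_upt_mult[OF h(1) h(1)] by simp
  then show ?thesis
    unfolding enc_nfi_def interdiction_def nfi.simps
    by (intro poly_comp_pair h b poly_comp_interdiction_edges poly_comp_plus poly_comp_num)
qed

subsection \<open>Reading off a vertex set\<close>

text \<open>
  Edge \<open>j\<close> of \<open>H\<close> has its triangle at the positions \<open>j\<close>, \<open>j + m\<close> and \<open>j + 2 m\<close>. A triangle that loses
  at most one edge stays connected; all other triangles cost at least \<open>2\<close>.
\<close>

definition intact :: "nat list \<Rightarrow> nat \<Rightarrow> nat \<Rightarrow> bool" where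
  "intact R m j \<longleftrightarrow> \<not> (j \<in> set R \<and> j + m \<in> set R) \<and> \<not> (j \<in> set R \<and> j + m + m \<in> set R) \<and>
    \<not> (j + m \<in> set R \<and> j + m + m \<in> set R)"

definition intact_edges :: "edges \<Rightarrow> nat list \<Rightarrow> (nat \<times> nat \<times> nat) list" where
  "intact_edges es R = filter (\<lambda>p. intact R (length es) (fst p)) (List.enumerate 0 es)"

definition spanned :: "nat \<Rightarrow> edges \<Rightarrow> nat list \<Rightarrow> nat list" where
  "spanned n es R =
    filter (\<lambda>v. filter (\<lambda>p. fst (snd p) = v \<or> snd (snd p) = v) (intact_edges es R) \<noteq> []) [0..<n]"

lemma poly_comp_intact:
  assumes "poly_comp V a (\<lambda>i. enc_list VNum (R i))" "poly_comp V a (\<lambda>i. VNum (m i))"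
    "poly_comp V a (\<lambda>i. VNum (j i))"
  shows "poly_comp V a (\<lambda>i. vbool (intact (R i) (m i) (j i)))"
  unfolding intact_def by (intro poly_comp_conj poly_comp_not poly_comp_mem poly_comp_plus assms)

lemma poly_comp_spanned:
  assumes vs: "poly_comp V a (\<lambda>i. enc_list VNum [0..<n i])"
    and es: "poly_comp V a (\<lambda>i. enc_list enc_dks_edge (es i))"
    and R: "poly_comp V a (\<lambda>i. enc_list VNum (R i))"
  shows "poly_comp V a (\<lambda>i. enc_list VNum (spanned (n i) (es i) (R i)))"
proof -
  have I: "poly_comp V a (\<lambda>i. enc_list (enc_prod VNum enc_dks_edge) (intact_edges (es i) (R i)))"
    unfolding intact_edges_def
    by (rule poly_comp_filter[OF poly_comp_enumerate[OF es]], rule poly_comp_intact)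
      (rule poly_comp_prodD poly_comp_fst_lift[OF R] poly_comp_fst_lift[OF poly_comp_length[OF es]], assumption)+
  show ?thesis
    unfolding spanned_def
  proof (rule poly_comp_filter[OF vs], rule poly_comp_nonempty)
    fix d assume d: "poly_comp (V \<times> UNIV) d (\<lambda>z. a (fst z))" "poly_comp (V \<times> UNIV) d (\<lambda>z. VNum (snd z))"
    show "poly_comp (V \<times> UNIV) d (\<lambda>z. enc_list (enc_prod VNum enc_dks_edge)
      (filter (\<lambda>p. fst (snd p) = snd z \<or> snd (snd p) = snd z) (intact_edges (es (fst z)) (R (fst z)))))"
    proof (rule poly_comp_filter[OF poly_comp_fst_lift[OF I d(1)]])
      fix d'
      assume d': "poly_comp ((V \<times> UNIV) \<times> UNIV) d' (\<lambda>z. d (fst z))"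
        "poly_comp ((V \<times> UNIV) \<times> UNIV) d' (\<lambda>z. enc_prod VNum enc_dks_edge (snd z))"
      show "poly_comp ((V \<times> UNIV) \<times> UNIV) d'
          (\<lambda>z. vbool (fst (snd (snd z)) = snd (fst z) \<or> snd (snd (snd z)) = snd (fst z)))"
        by (intro poly_comp_disj poly_comp_eq_num poly_comp_dks_edgeD[OF poly_comp_prodD(2)[OF d'(2)]]
            poly_comp_fst_lift[OF d(2) d'(1)])
    qed
  qed
qed

text \<open>On valid instances at most one of the two operations changes the set: \<open>pad\<close>
  returns a set of at least \<open>k\<close> vertices as it is and otherwise stops at
  \<open>k\<close>, which leaves nothing to shrink. The clock has \<open>n\<close> ticks, enough for
  any set of vertices.\<close>

definition candidate :: "dks \<Rightarrow> nat list \<Rightarrow> nat list" where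
  "candidate H R = shrink (dks_k H) (dks_edges H) [0..<dks_n H]
    (pad (dks_k H) [0..<dks_n H] (spanned (dks_n H) (dks_edges H) R))"

text \<open>The index \<open>i\<close> is the guess for \<open>m - l\<close>, hence the budget
  \<open>i + i\<close>, written with the addition that the machine offers. The default, some
  \<open>k\<close> vertices, covers graphs without edges.\<close>

definition solution :: "(nfi \<Rightarrow> nat list) \<Rightarrow> dks \<Rightarrow> nat list" where
  "solution r H = densest_of (dks_edges H)
    (map (\<lambda>i. candidate H (r (interdiction H (i + i)))) [0..<length (dks_edges H)])
    (pad (dks_k H) [0..<dks_n H] [])"

lemma poly_comp_candidate:
  assumes "poly_comp V a (\<lambda>i. enc_dks (H i))" "poly_comp V a (\<lambda>i. enc_list VNum (R i))"
  shows "poly_comp V a (\<lambda>i. enc_list VNum (candidate (H i) (R i)))"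
  unfolding candidate_def
  by (intro poly_comp_shrink poly_comp_pad poly_comp_spanned poly_comp_dksD[OF assms(1)] assms(2))

lemma poly_comp_solution:
  assumes r: "poly_comp {I. nfi_valid I} enc_nfi (\<lambda>I. enc_list VNum (r I))"
    and valid: "\<And>H b. dks_valid H \<Longrightarrow> nfi_valid (interdiction H b)"
  shows "poly_comp {H. dks_valid H} enc_dks (\<lambda>H. enc_list VNum (solution r H))"
  unfolding solution_def
proof (rule poly_comp_densest_of)
  let ?V = "{H. dks_valid H}"
  note h = poly_comp_dksD[OF poly_comp_refl, of ?V]
  show "poly_comp ?V enc_dks (\<lambda>H. enc_list enc_dks_edge (dks_edges H))" by (rule h)
  show "poly_comp ?V enc_dks (\<lambda>H. enc_list VNum (pad (dks_k H) [0..<dks_n H] []))"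
    by (intro poly_comp_pad h poly_comp_nil)
  show "poly_comp ?V enc_dks (\<lambda>H. enc_list (enc_list VNum)
      (map (\<lambda>i. candidate H (r (interdiction H (i + i)))) [0..<length (dks_edges H)]))"
  proof (rule poly_comp_map[OF poly_comp_upt[OF h(2)]], rule poly_comp_candidate, assumption)
    fix d assume d: "poly_comp (?V \<times> UNIV) d (\<lambda>z. enc_dks (fst z))" "poly_comp (?V \<times> UNIV) d (\<lambda>z. VNum (snd z))"
    show "poly_comp (?V \<times> UNIV) d (\<lambda>z. enc_list VNum (r (interdiction (fst z) (snd z + snd z))))"
      by (rule poly_comp_call[OF r poly_comp_interdiction[OF d(1) poly_comp_plus[OF d(2) d(2)]]])
        (auto intro: valid)
  qed
qed

subsection \<open>Greedy deletion\<close>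

lemma densest_of_ge:
  "edge_count es W \<le> edge_count es (densest_of es cs W)"
  "c \<in> set cs \<Longrightarrow> edge_count es c \<le> edge_count es (densest_of es cs W)"
proof -
  show *: "edge_count es W \<le> edge_count es (densest_of es cs W)" for cs W
    unfolding densest_of_def by (induction cs arbitrary: W) (auto intro: order_trans less_imp_le)
  show "edge_count es c \<le> edge_count es (densest_of es cs W)" if "c \<in> set cs"
    using that
  proof (induction cs arbitrary: W)
    case (Cons c' cs)
    let ?W = "if edge_count es W < edge_count es c' then c' else W"
    have eq: "densest_of es (c' # cs) W = densest_of es cs ?W" by (simp add: densest_of_def)
    show ?case
    proof (cases "c = c'")
      case True
      then have "edge_count es c \<le> edge_count es ?W" by simp
      then show ?thesis using *[of ?W cs] unfolding eq by (rule order_trans)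
    next
      case False
      then show ?thesis using Cons unfolding eq by simp
    qed
  qed simp
qed

lemma edge_count_mono: "set W \<subseteq> set W' \<Longrightarrow> edge_count es W \<le> edge_count es W'"
  unfolding edge_count_def by (induction es) auto

lemma edge_count_nth:
  "edge_count es W = card {j. j < length es \<and> fst (es ! j) \<in> set W \<and> snd (es ! j) \<in> set W}"
  unfolding edge_count_def by (rule length_filter_conv_card)

text \<open>An edge inside \<open>W\<close> is lost for exactly two of the vertices \<open>v\<close>, its ends.\<close>

lemma sum_edge_count_remove:
  assumes "distinct W" "\<forall>e\<in>set es. fst e \<noteq> snd e"
  shows "(\<Sum>v\<leftarrow>W. edge_count es (filter (\<lambda>w. w \<noteq> v) W)) + 2 * edge_count es W =
    length W * edge_count es W"
  using assms(2)
proof (induction es)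
  case (Cons e es)
  let ?in = "fst e \<in> set W \<and> snd e \<in> set W"
  have ec: "edge_count (e # es) X = of_bool (fst e \<in> set X \<and> snd e \<in> set X) + edge_count es X" for X
    by (simp add: edge_count_def)
  have "(\<Sum>v\<leftarrow>W. of_bool (?in \<and> fst e \<noteq> v \<and> snd e \<noteq> v)) + 2 * of_bool ?in = length W * of_bool ?in"
  proof (cases ?in)
    case True
    have "(\<Sum>v\<leftarrow>W. of_bool (?in \<and> fst e \<noteq> v \<and> snd e \<noteq> v)) =
        (\<Sum>v\<in>set W. of_bool (fst e \<noteq> v \<and> snd e \<noteq> v))"
      using assms(1) True by (simp add: sum_list_distinct_conv_sum_set)
    also have "\<dots> = card (set W - {fst e, snd e})"
      by (subst of_bool_def, subst sum.inter_filter[symmetric]) (auto intro!: arg_cong[of _ _ card])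
    also have "\<dots> = length W - 2"
      using True Cons.prems by (subst card_Diff_subset) (simp_all add: distinct_card[OF assms(1)])
    finally have *: "(\<Sum>v\<leftarrow>W. of_bool (?in \<and> fst e \<noteq> v \<and> snd e \<noteq> v)) = length W - 2" .
    \<comment> \<open>Guarantees that the truncated subtraction in \<open>length W - 2\<close> is
      exact.\<close>
    have "card {fst e, snd e} \<le> card (set W)" using True by (intro card_mono) auto
    then have "2 \<le> length W" using Cons.prems by (simp add: distinct_card[OF assms(1)])
    with * True show ?thesis by simp
  next
    case False
    then show ?thesis by (simp only: simp_thms of_bool_eq sum_list_0 mult_0_right add_0)
  qed
  moreover have "(\<Sum>v\<leftarrow>W. edge_count (e # es) (filter (\<lambda>w. w \<noteq> v) W)) =
    (\<Sum>v\<leftarrow>W. of_bool (?in \<and> fst e \<noteq> v \<and> snd e \<noteq> v)) + (\<Sum>v\<leftarrow>W. edge_count es (filter (\<lambda>w. w \<noteq> v) W))"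
    unfolding ec sum_list_addf[symmetric]
    by (intro arg_cong[of _ _ sum_list] map_cong refl) auto
  moreover have "(\<Sum>v\<leftarrow>W. edge_count es (filter (\<lambda>w. w \<noteq> v) W)) + 2 * edge_count es W =
    length W * edge_count es W"
    using Cons by simp
  ultimately show ?case unfolding ec by (simp add: algebra_simps)
qed (simp add: edge_count_def sum_list_0)

lemma length_filter_neq: "distinct W \<Longrightarrow> v \<in> set W \<Longrightarrow> length (filter (\<lambda>w. w \<noteq> v) W) = length W - 1"
  using length_remove1[of v W] distinct_remove1_removeAll[of W v] removeAll_filter_not_eq[of v]
  by (simp add: neq_commute)

lemma drop_vertex:
  assumes "distinct W" "W \<noteq> []"
  shows "distinct (drop_vertex es W)" "set (drop_vertex es W) \<subseteq> set W"
    "length (drop_vertex es W) = length W - 1"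
  using densest_of_cases[of es "map (\<lambda>v. filter (\<lambda>w. w \<noteq> v) W) W" "tl W"] assms
  by (auto simp: drop_vertex_def distinct_tl length_filter_neq dest: list.set_sel(2))

text \<open>Half the usual edge density: the denominator counts ordered pairs. With this
  normalisation greedy deletion is monotone.\<close>

definition density :: "edges \<Rightarrow> nat list \<Rightarrow> real" where
  "density es W = edge_count es W / (real (length W) * (real (length W) - 1))"

text \<open>Averaging: the \<open>w\<close> sets obtained by deleting one vertex together keep
  \<open>w - 2\<close> times the edges of \<open>W\<close>, so the best of them keeps at least the
  fraction \<open>(w - 2) / w\<close>. This is exactly the ratio of \<open>(w - 1) (w - 2)\<close>
  to \<open>w (w - 1)\<close>.\<close>

lemma density_drop_vertex:
  assumes "distinct W" "\<forall>e\<in>set es. fst e \<noteq> snd e" "2 < length W"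
  shows "density es W \<le> density es (drop_vertex es W)"
proof -
  let ?w = "real (length W)"
  have "(\<Sum>v\<leftarrow>W. edge_count es (filter (\<lambda>w. w \<noteq> v) W)) \<le>
      (\<Sum>v\<leftarrow>W. edge_count es (drop_vertex es W))"
    unfolding drop_vertex_def by (intro sum_list_mono densest_of_ge) auto
  then have "(\<Sum>v\<leftarrow>W. edge_count es (filter (\<lambda>w. w \<noteq> v) W)) \<le> length W * edge_count es (drop_vertex es W)"
    by (simp add: sum_list_triv)
  then have "length W * edge_count es W \<le> length W * edge_count es (drop_vertex es W) + 2 * edge_count es W"
    using sum_edge_count_remove[OF assms(1,2)] by linarith
  then have "?w * edge_count es W \<le> ?w * edge_count es (drop_vertex es W) + 2 * edge_count es W"
    by (metis of_nat_add of_nat_le_iff of_nat_mult of_nat_numeral)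
  then have "(?w - 2) * edge_count es W \<le> ?w * edge_count es (drop_vertex es W)"
    by (simp add: algebra_simps)
  then have "(?w - 1) * ((?w - 2) * edge_count es W) \<le> (?w - 1) * (?w * edge_count es (drop_vertex es W))"
    using assms(3) by (intro mult_left_mono) auto
  moreover have "real (length (drop_vertex es W)) = ?w - 1"
    using drop_vertex(3)[of W es] assms(1,3) by force
  ultimately show ?thesis
    using assms(3) by (simp add: density_def divide_simps) (simp add: algebra_simps)
qed

text \<open>The length formula tracks how far the clock allows the deletion to go. The density claim
  asks for \<open>2 \<le> k\<close> so that every deletion starts from more than two
  vertices.\<close>

lemma shrink:
  assumes "distinct W" "0 < k" "k \<le> length W"
  shows "distinct (shrink k es vs W) \<and> set (shrink k es vs W) \<subseteq> set W \<and>
    length (shrink k es vs W) = max k (length W - length vs) \<and>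
    ((\<forall>e\<in>set es. fst e \<noteq> snd e) \<longrightarrow> 2 \<le> k \<longrightarrow> density es W \<le> density es (shrink k es vs W))"
  using assms(1,3)
proof (induction vs arbitrary: W)
  case Nil
  then show ?case by (simp add: shrink_def)
next
  case (Cons v vs)
  show ?case
  proof (cases "k < length W")
    case True
    have "W \<noteq> []" using True by auto
    note d = drop_vertex[OF Cons.prems(1) this, of es]
    have eq: "shrink k es (v # vs) W = shrink k es vs (drop_vertex es W)"
      using True by (simp add: shrink_def)
    have "k \<le> length (drop_vertex es W)" using d(3) True by simp
    note ih = Cons.IH[OF d(1) this]
    have "density es W \<le> density es (drop_vertex es W)" if "\<forall>e\<in>set es. fst e \<noteq> snd e" "2 \<le> k"
      using density_drop_vertex[OF Cons.prems(1) that(1)] True that by simp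
    with ih d(2,3) True show ?thesis unfolding eq by fastforce
  next
    case False
    then have "shrink k es (v # vs) W = shrink k es vs W" "length W = k"
      using Cons.prems by (simp_all add: shrink_def)
    then show ?thesis using Cons.IH[of W] Cons.prems by simp
  qed
qed

lemma pad:
  assumes "distinct W"
  shows "distinct (pad k vs W) \<and> set W \<subseteq> set (pad k vs W) \<and> set (pad k vs W) \<subseteq> set W \<union> set vs \<and>
    (length W \<le> k \<longrightarrow> length (pad k vs W) \<le> k) \<and> (k \<le> length W \<longrightarrow> pad k vs W = W) \<and>
    (k \<le> length (pad k vs W) \<or> set vs \<subseteq> set (pad k vs W))"
  using assms
proof (induction vs arbitrary: W)
  case Nil
  then show ?case by (simp add: pad_def)
next
  case (Cons v vs)
  show ?case
  proof (cases "length W < k \<and> v \<notin> set W")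
    case True
    then have "pad k (v # vs) W = pad k vs (v # W)" by (simp add: pad_def)
    then show ?thesis using Cons.IH[of "v # W"] Cons.prems True by auto
  next
    case False
    then have "pad k (v # vs) W = pad k vs W" by (auto simp: pad_def)
    then show ?thesis using Cons.IH[of W] Cons.prems False by auto
  qed
qed

text \<open>Stopping below \<open>k\<close> would mean that all of \<open>[0..<n]\<close> has been
  absorbed, which gives at least \<open>n \<ge> k\<close> vertices.\<close>

lemma length_pad_upt:
  assumes "distinct W" "length W \<le> k" "k \<le> n"
  shows "length (pad k [0..<n] W) = k"
proof -
  note p = pad[OF assms(1), of k "[0..<n]"]
  have "k \<le> length (pad k [0..<n] W)"
  proof (rule ccontr)
    assume *: "\<not> k \<le> length (pad k [0..<n] W)"
    then have "{0..<n} \<subseteq> set (pad k [0..<n] W)" using p by simp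
    then have "n \<le> card (set (pad k [0..<n] W))" using card_mono[of _ "{0..<n}"] by fastforce
    then show False using * assms(3) card_length[of "pad k [0..<n] W"] by linarith
  qed
  then show ?thesis using p assms(2) by simp
qed

lemma length_le_of_subset: "distinct W \<Longrightarrow> set W \<subseteq> {..<n} \<Longrightarrow> length W \<le> n" for n :: nat
  using card_mono[of "{..<n}" "set W"] by (simp add: distinct_card)

lemma spanned: "distinct (spanned n es R)" "set (spanned n es R) \<subseteq> {..<n}"
  by (auto simp: spanned_def)

lemma candidate:
  assumes "dks_valid H"
  shows "distinct (candidate H R)" "set (candidate H R) \<subseteq> {..<dks_n H}"
    "length (candidate H R) = dks_k H"
    "edge_count (dks_edges H) (spanned (dks_n H) (dks_edges H) R) \<le> edge_count (dks_edges H) (candidate H R) \<or>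
     dks_k H < length (spanned (dks_n H) (dks_edges H) R) \<and> (2 \<le> dks_k H \<longrightarrow>
     density (dks_edges H) (spanned (dks_n H) (dks_edges H) R) \<le> density (dks_edges H) (candidate H R))"
proof -
  let ?n = "dks_n H" and ?es = "dks_edges H" and ?k = "dks_k H"
  have k: "0 < ?k" "?k \<le> ?n" using assms by (auto simp: dks_valid_def)
  have ne: "\<forall>e\<in>set ?es. fst e \<noteq> snd e" using assms by (auto simp: dks_valid_def)
  let ?W = "spanned ?n ?es R"
  let ?P = "pad ?k [0..<?n] ?W"
  note W = spanned[of ?n ?es R]
  have P: "distinct ?P" "set ?P \<subseteq> {..<?n}" using pad[OF W(1), of ?k "[0..<?n]"] W(2) by auto
  have Pk: "?k \<le> length ?P"
    using length_pad_upt[OF W(1) _ k(2)] pad[OF W(1), of ?k "[0..<?n]"] by (cases "length ?W \<le> ?k") auto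
  note c = shrink[OF P(1) k(1) Pk, of ?es "[0..<?n]", folded candidate_def]
  show "distinct (candidate H R)" "set (candidate H R) \<subseteq> {..<?n}" using c P by auto
  show len: "length (candidate H R) = ?k" using c length_le_of_subset[OF P] by simp
  show "edge_count ?es ?W \<le> edge_count ?es (candidate H R) \<or>
    ?k < length ?W \<and> (2 \<le> ?k \<longrightarrow> density ?es ?W \<le> density ?es (candidate H R))"
  proof (cases "length ?W \<le> ?k")
    case True
    then have Pk': "length ?P = ?k" using length_pad_upt[OF W(1) _ k(2)] by simp
    \<comment> \<open>The padded set already has \<open>k\<close> elements, so a subset of size
      \<open>k\<close> is the set itself.\<close>
    have "set (candidate H R) = set ?P"
      using c Pk' len P(1) by (intro card_subset_eq) (auto simp: distinct_card)
    then show ?thesis using edge_count_mono[of ?W "candidate H R" ?es] pad[OF W(1), of ?k "[0..<?n]"] by simp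
  next
    case False
    then have "?P = ?W" using pad[OF W(1), of ?k "[0..<?n]"] by simp
    then show ?thesis using c ne False by simp
  qed
qed

text \<open>\<open>edge_count\<close> counts list entries; \<open>dks_valid\<close> forbids repeated
  edges in either orientation, so entries and edges correspond.\<close>

lemma dks_value_edge_count:
  assumes "dks_valid H"
  shows "dks_value H (set W) = edge_count (dks_edges H) W"
proof -
  let ?f = "\<lambda>(u, v). {u, v :: nat}"
  let ?es = "filter (\<lambda>e. fst e \<in> set W \<and> snd e \<in> set W) (dks_edges H)"
  have d: "distinct (map ?f ?es)"
    using assms unfolding dks_valid_def by (intro distinct_map_filter) blast
  have "{e \<in> dks_E H. e \<subseteq> set W} = set (map ?f ?es)"
    unfolding dks_E_def by auto
  then show ?thesis
    unfolding dks_value_def edge_count_def using distinct_card[OF d] by simp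
qed

lemma solution:
  assumes "dks_valid H"
  shows "distinct (solution r H)" "dks_feasible H (set (solution r H))"
    "i < length (dks_edges H) \<Longrightarrow>
      edge_count (dks_edges H) (candidate H (r (interdiction H (i + i)))) \<le> dks_value H (set (solution r H))"
proof -
  let ?cs = "map (\<lambda>i. candidate H (r (interdiction H (i + i)))) [0..<length (dks_edges H)]"
  let ?P = "pad (dks_k H) [0..<dks_n H] []"
  have "dks_k H \<le> dks_n H" using assms by (simp add: dks_valid_def)
  then have "distinct ?P" "set ?P \<subseteq> {..<dks_n H}" "length ?P = dks_k H"
    using pad[of "[]" "dks_k H" "[0..<dks_n H]"] length_pad_upt[of "[]" "dks_k H" "dks_n H"] by auto
  then have "distinct (solution r H) \<and> set (solution r H) \<subseteq> {..<dks_n H} \<and> length (solution r H) = dks_k H"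
    using densest_of_cases[of "dks_edges H" ?cs ?P] candidate(1,3)[OF assms]
      candidate(2)[OF assms, THEN subsetD] unfolding solution_def by auto
  then show "distinct (solution r H)" "dks_feasible H (set (solution r H))"
    by (auto simp: dks_feasible_def distinct_card)
  show "edge_count (dks_edges H) (candidate H (r (interdiction H (i + i)))) \<le> dks_value H (set (solution r H))"
    if "i < length (dks_edges H)"
    unfolding dks_value_edge_count[OF assms] solution_def using that by (intro densest_of_ge) auto
qed

section \<open>Flows and cuts\<close>

text \<open>The coefficient of edge \<open>i\<close> in the net flow leaving \<open>U\<close>; it
  vanishes unless the edge crosses the cut.\<close>

definition incidence :: "nfi \<Rightarrow> nat \<Rightarrow> nat set \<Rightarrow> real" where
  "incidence I i U = of_bool (end1 (nfi_edges I ! i) \<in> U) - of_bool (end2 (nfi_edges I ! i) \<in> U)"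

lemma net_outflow_incidence:
  assumes "finite F"
  shows "net_outflow I F f x = (\<Sum>i\<in>F. f i * incidence I i {x})"
proof -
  have "(\<Sum>i\<in>{i \<in> F. P i}. f i) = (\<Sum>i\<in>F. f i * of_bool (P i))" for P
    using sum.inter_filter[OF assms, of f P] by (simp add: of_bool_def if_distrib cong: if_cong)
  then show ?thesis
    by (simp add: net_outflow_def incidence_def sum_subtractf[symmetric] right_diff_distrib)
qed

text \<open>Edges with both ends inside \<open>U\<close> cancel, which leaves the flow across the
  cut. This is the easy half of cut duality.\<close>

lemma sum_net_outflow:
  assumes "finite F" "finite U"
  shows "(\<Sum>x\<in>U. net_outflow I F f x) = (\<Sum>i\<in>F. f i * incidence I i U)"
proof -
  have "(\<Sum>x\<in>U. incidence I i {x}) = incidence I i U" for i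
    using assms(2) by (simp add: incidence_def sum_subtractf of_bool_def)
  then show ?thesis
    by (simp add: net_outflow_incidence[OF assms(1)] sum.swap[of _ F] sum_distrib_left[symmetric])
qed

lemma abs_incidence_le: "\<bar>incidence I i U\<bar> \<le> 1"
  by (simp add: incidence_def of_bool_def)

lemma finite_nfi_E: "finite (nfi_E I)"
  by (simp add: nfi_E_def)

lemma sum_of_bool_card: "finite A \<Longrightarrow> (\<Sum>i\<in>A. of_bool (P i)) = of_nat (card {i \<in> A. P i})"
  by (simp add: Int_def)

text \<open>\<open>Sup\<close> dominates its members only for sets bounded above; the total capacity
  of \<open>F\<close> is such a bound.\<close>

lemma max_flow_value_ge:
  assumes "finite F" "is_flow I F f"
  shows "net_outflow I F f (nfi_source I) \<le> max_flow_value I F"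
  unfolding max_flow_value_def
proof (rule cSup_upper)
  show "bdd_above {net_outflow I F f (nfi_source I) |f. is_flow I F f}"
  proof (rule bdd_aboveI)
    fix y assume "y \<in> {net_outflow I F f (nfi_source I) |f. is_flow I F f}"
    then obtain g where y: "y = net_outflow I F g (nfi_source I)" and g: "is_flow I F g" by blast
    have "g i * incidence I i {nfi_source I} \<le> capacity (nfi_edges I ! i)" if "i \<in> F" for i
    proof -
      have "g i * incidence I i {nfi_source I} \<le> \<bar>g i\<bar> * \<bar>incidence I i {nfi_source I}\<bar>"
        by (metis abs_ge_self abs_mult)
      also have "\<dots> \<le> \<bar>g i\<bar>" using abs_incidence_le by (simp add: mult_left_le)
      also have "\<dots> \<le> capacity (nfi_edges I ! i)" using g that by (simp add: is_flow_def)
      finally show ?thesis .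
    qed
    then show "y \<le> (\<Sum>i\<in>F. real (capacity (nfi_edges I ! i)))"
      unfolding y net_outflow_incidence[OF assms(1)] by (rule sum_mono)
  qed
qed (use assms(2) in blast)

lemma max_flow_value_le:
  assumes "\<And>f. is_flow I F f \<Longrightarrow> net_outflow I F f (nfi_source I) \<le> c"
  shows "max_flow_value I F \<le> c"
  unfolding max_flow_value_def
proof (rule cSup_least)
  have "is_flow I F (\<lambda>_. 0)" by (simp add: is_flow_def net_outflow_def)
  then show "{net_outflow I F f (nfi_source I) |f. is_flow I F f} \<noteq> {}" by blast
qed (use assms in blast)

lemma finite_nfi_feasible: "finite {R. nfi_feasible I R}"
  by (rule finite_subset[of _ "Pow (nfi_E I)"]) (auto simp: nfi_feasible_def finite_nfi_E)

lemma nfi_opt_le: "nfi_feasible I R \<Longrightarrow> nfi_opt I \<le> nfi_value I R"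
  unfolding nfi_opt_def by (intro Min_le finite_imageI finite_nfi_feasible) simp

lemma nfi_opt_attained: "\<exists>R. nfi_feasible I R \<and> nfi_opt I = nfi_value I R"
proof -
  have "nfi_feasible I {}" by (simp add: nfi_feasible_def)
  then have "nfi_opt I \<in> nfi_value I ` {R. nfi_feasible I R}"
    unfolding nfi_opt_def by (intro Min_in finite_imageI finite_nfi_feasible) blast
  then show ?thesis by blast
qed


section \<open>Correctness of the reduction\<close>

lemma sum_lessThan_add:
  fixes f :: "nat \<Rightarrow> 'a::comm_monoid_add"
  shows "(\<Sum>i<a + b. f i) = (\<Sum>i<a. f i) + (\<Sum>i<b. f (i + a))"
  by (induction b) (simp_all add: ac_simps)

text \<open>The budget \<open>b\<close> is left arbitrary: a valid instance is needed for every
  trial, and only \<open>solution_approx\<close> ties it to the optimum.\<close>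

locale reduction =
  fixes H :: dks and b :: nat
  assumes valid: "dks_valid H"
begin

abbreviation "n \<equiv> dks_n H"
abbreviation "es \<equiv> dks_edges H"
abbreviation "m \<equiv> length (dks_edges H)"
abbreviation "I \<equiv> interdiction H b"

lemma n_ge_2: "2 \<le> n"
  using valid by (auto simp: dks_valid_def)

lemma n_plus_2_le: "n + 2 \<le> n * n"
proof -
  have "2 * n \<le> n * n" by (rule mult_le_mono1[OF n_ge_2])
  then show ?thesis using n_ge_2 by linarith
qed

lemma edge_bounds: "e \<in> set es \<Longrightarrow> fst e < n \<and> snd e < n \<and> fst e \<noteq> snd e"
  using valid by (auto simp: dks_valid_def)

lemma es_bounds: "j < m \<Longrightarrow> fst (es ! j) < n" "j < m \<Longrightarrow> snd (es ! j) < n"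
  "j < m \<Longrightarrow> fst (es ! j) \<noteq> snd (es ! j)"
  using edge_bounds[OF nth_mem] by blast+

lemma I_simps [simp]: "nfi_n I = n * n" "nfi_source I = n" "nfi_sink I = n + 1" "nfi_budget I = b"
  "nfi_edges I = interdiction_edges n es b"
  by (simp_all add: interdiction_def)

lemma length_edges: "length (interdiction_edges n es b) = m + m + m + n"
  by (simp add: interdiction_edges_def)

lemma nth_edges [simp]:
  "j < m \<Longrightarrow> interdiction_edges n es b ! j = nfi_edge_of (fst (es ! j)) (snd (es ! j)) 2 1"
  "j < m \<Longrightarrow> interdiction_edges n es b ! (j + m) = nfi_edge_of (fst (es ! j)) (n + 1) 2 1"
  "j < m \<Longrightarrow> interdiction_edges n es b ! (j + (m + m)) = nfi_edge_of (snd (es ! j)) (n + 1) 2 1"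
  "v < n \<Longrightarrow> interdiction_edges n es b ! (v + (m + (m + m))) = nfi_edge_of n v 1 (b + 1)"
  by (simp_all add: interdiction_edges_def nth_append)

lemma nfi_valid_I: "nfi_valid I"
proof -
  have "fst e < n * n \<and> snd e < n * n \<and> fst e \<noteq> snd e \<and> fst e \<noteq> n + 1 \<and> snd e \<noteq> n + 1"
    if "e \<in> set es" for e
    using edge_bounds[OF that] n_plus_2_le by linarith
  moreover have "n < n * n" "n + 1 < n * n" using n_plus_2_le by linarith+
  ultimately show ?thesis
    unfolding nfi_valid_def I_simps interdiction_edges_def by auto
qed

lemma nfi_E_I: "nfi_E I = {..<m + m + m + n}"
  by (simp add: nfi_E_def length_edges)

text \<open>\<open>i mod m\<close> recovers the triangle from the position of any of its edges, so
  paths that share a triangle edge are recognised as using the same triangle.\<close>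

lemma edge_cases:
  assumes "i < m + m + m + n"
  obtains (triangle) j where "j < m" "i = j \<or> i = j + m \<or> i = j + (m + m)" "i < m + m + m" "i mod m = j"
  | (source) v where "v < n" "i = v + (m + (m + m))" "\<not> i < m + m + m"
proof (cases "i < m + m + m")
  case True
  then have "0 < m" by (cases m) auto
  consider "i < m" | "m \<le> i" "i < m + m" | "m + m \<le> i" by linarith
  then show ?thesis
  proof cases
    case 1
    then show ?thesis by (intro triangle[of i]) simp_all
  next
    case 2
    then obtain k where "i = k + m" using 2 le_add_diff_inverse2 by metis
    with 2 True show ?thesis by (intro triangle[of k]) simp_all
  next
    case 3
    then obtain k where "i = k + (m + m)" using 3 le_add_diff_inverse2 by metis
    moreover have "(k + (m + m)) mod m = k mod m" by (simp flip: add.assoc)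
    ultimately show ?thesis using True by (intro triangle[of k]) simp_all
  qed
next
  case False
  then show ?thesis using source[of "i - (m + m + m)"] assms by auto
qed

lemma incidence_I:
  "j < m \<Longrightarrow> incidence I j U = of_bool (fst (es ! j) \<in> U) - of_bool (snd (es ! j) \<in> U)"
  "j < m \<Longrightarrow> incidence I (j + m) U = of_bool (fst (es ! j) \<in> U) - of_bool (n + 1 \<in> U)"
  "j < m \<Longrightarrow> incidence I (j + (m + m)) U = of_bool (snd (es ! j) \<in> U) - of_bool (n + 1 \<in> U)"
  "v < n \<Longrightarrow> incidence I (v + (m + (m + m))) U = of_bool (n \<in> U) - of_bool (v \<in> U)"
  by (simp_all add: incidence_def)

lemma triangle_edge:
  assumes "i < m + m + m"
  shows "capacity (interdiction_edges n es b ! i) = 2 \<and> cost (interdiction_edges n es b ! i) = 1"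
proof -
  from assms have "i < m + m + m + n" by simp
  then show ?thesis
  proof (cases rule: edge_cases)
    case (triangle j)
    from triangle(1,2) show ?thesis by auto
  qed (use assms in simp)
qed

subsection \<open>Every feasible set leaves a dense subgraph connected to the sink\<close>

lemma feasible_source:
  assumes "nfi_feasible I R" "v < n"
  shows "v + (m + (m + m)) \<notin> R"
proof
  assume *: "v + (m + (m + m)) \<in> R"
  have "finite R" using assms(1) finite_subset[OF _ finite_nfi_E] by (auto simp: nfi_feasible_def)
  then have "cost (nfi_edges I ! (v + (m + (m + m)))) \<le> (\<Sum>i\<in>R. cost (nfi_edges I ! i))"
    using * by (intro member_le_sum) auto
  also have "\<dots> \<le> b" using assms(1) by (simp add: nfi_feasible_def)
  finally show False using assms(2) by simp
qed

lemma card_intact: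
  assumes "nfi_feasible I (set R)"
  shows "2 * m \<le> b + 2 * card {j. j < m \<and> intact R m j}"
proof -
  let ?r = "\<lambda>i. of_bool (i \<in> set R) :: nat"
  have "(\<Sum>i<m + m + m. ?r i) = (\<Sum>i\<in>{i\<in>{..<m + m + m}. i \<in> set R}. 1)"
    unfolding sum_of_bool_card[OF finite_lessThan] by simp
  also have "\<dots> = (\<Sum>i\<in>{i\<in>{..<m + m + m}. i \<in> set R}. cost (nfi_edges I ! i))"
    by (intro sum.cong) (auto simp: triangle_edge)
  also have "\<dots> \<le> (\<Sum>i\<in>set R. cost (nfi_edges I ! i))" by (intro sum_mono2) auto
  also have "\<dots> \<le> b" using assms by (simp add: nfi_feasible_def)
  finally have 1: "(\<Sum>i<m + m + m. ?r i) \<le> b" .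
  have "2 * m = (\<Sum>j<m. 2)" by simp
  \<comment> \<open>A triangle that is not intact has lost at least two edges, so every summand is
    at least \<open>2\<close>.\<close>
  also have "\<dots> \<le> (\<Sum>j<m. ?r j + ?r (j + m) + ?r (j + (m + m)) + 2 * of_bool (intact R m j))"
    by (intro sum_mono) (auto simp: intact_def add.assoc)
  also have "\<dots> = (\<Sum>i<m + m + m. ?r i) + 2 * (\<Sum>j<m. of_bool (intact R m j))"
    by (simp add: sum_lessThan_add sum.distrib sum_distrib_left)
  also have "(\<Sum>j<m. of_bool (intact R m j) :: nat) = card {j. j < m \<and> intact R m j}"
    by (simp add: sum_of_bool_card del: sum_of_bool_eq)
  finally show ?thesis using 1 by linarith
qed

lemma spanned_iff:
  "v \<in> set (spanned n es R) \<longleftrightarrow> (\<exists>j<m. intact R m j \<and> (fst (es ! j) = v \<or> snd (es ! j) = v))"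
proof -
  have "set (intact_edges es R) = (\<lambda>j. (j, es ! j)) ` {j. j < m \<and> intact R m j}"
    by (auto simp: intact_edges_def in_set_enumerate_eq image_iff)
  then have "filter (\<lambda>p. fst (snd p) = v \<or> snd (snd p) = v) (intact_edges es R) \<noteq> [] \<longleftrightarrow>
    (\<exists>j<m. intact R m j \<and> (fst (es ! j) = v \<or> snd (es ! j) = v))"
    unfolding filter_empty_conv by auto
  then show ?thesis using es_bounds by (auto simp: spanned_def)
qed

text \<open>Both ends of an intact edge are spanned, so all intact edges lie inside the spanned set,
  possibly together with others.\<close>

lemma edge_count_spanned:
  assumes "nfi_feasible I (set R)"
  shows "2 * m \<le> b + 2 * edge_count es (spanned n es R)"
proof -
  have "card {j. j < m \<and> intact R m j} \<le> edge_count es (spanned n es R)"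
    unfolding edge_count_nth by (intro card_mono) (auto simp: spanned_iff)
  then show ?thesis using card_intact[OF assms] by linarith
qed

definition unit_flow :: "nat \<Rightarrow> real \<Rightarrow> nat \<Rightarrow> real" where
  "unit_flow i c = (\<lambda>i'. if i' = i then c else 0)"

lemma net_outflow_unit_flow:
  "finite F \<Longrightarrow> i \<in> F \<Longrightarrow> net_outflow I F (unit_flow i c) x = c * incidence I i {x}"
  by (simp add: net_outflow_incidence unit_flow_def if_distrib[of "\<lambda>y. y * _"] sum.delta cong: if_cong)

lemma net_outflow_add:
  "finite F \<Longrightarrow> net_outflow I F (\<lambda>i. f i + g i) x = net_outflow I F f x + net_outflow I F g x"
  by (simp add: net_outflow_incidence sum.distrib distrib_right)

text \<open>Two edges of an intact triangle still connect both ends of the edge to the sink.\<close>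

lemma path_flow:
  assumes R: "nfi_feasible I (set R)" and j: "j < m" "intact R m j" and v: "fst (es ! j) = v \<or> snd (es ! j) = v"
  shows "\<exists>f. (\<forall>x. net_outflow I (nfi_E I - set R) f x = of_bool (x = n) - of_bool (x = n + 1)) \<and>
    (\<forall>i. \<bar>f i\<bar> \<le> of_bool (i = v + (m + (m + m))) + of_bool (i \<in> {j, j + m, j + (m + m)}))"
proof -
  let ?F = "nfi_E I - set R"
  have fin: "finite ?F" using finite_nfi_E by blast
  have vn: "v < n" using es_bounds j(1) v by auto
  let ?s = "v + (m + (m + m))"
  have sF: "?s \<in> ?F" using vn feasible_source[OF R vn] by (simp add: nfi_E_I)
  have tF: "j \<in> ?F \<longleftrightarrow> j \<notin> set R" "j + m \<in> ?F \<longleftrightarrow> j + m \<notin> set R"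
    "j + (m + m) \<in> ?F \<longleftrightarrow> j + (m + m) \<notin> set R"
    using j(1) by (auto simp: nfi_E_I)
  note ne = es_bounds[OF j(1)]
  note out = net_outflow_add[OF fin] net_outflow_unit_flow[OF fin] incidence_I(1-3)[OF j(1)] incidence_I(4)[OF vn]
  \<comment> \<open>From \<open>v\<close> the sink is reached directly or by a detour through the
    other end of edge \<open>j\<close>. The detour uses the two remaining edges of the triangle, and
    at most one of the three is gone.\<close>
  consider "fst (es ! j) = v" "j + m \<in> ?F" | "fst (es ! j) = v" "j \<in> ?F" "j + (m + m) \<in> ?F"
    | "snd (es ! j) = v" "j + (m + m) \<in> ?F" | "snd (es ! j) = v" "j \<in> ?F" "j + m \<in> ?F"
    using v j(2) tF unfolding intact_def add.assoc by blast
  then show ?thesis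
  proof cases
    case 1
    then show ?thesis using sF ne j(1)
      by (intro exI[of _ "\<lambda>i. unit_flow ?s 1 i + unit_flow (j + m) 1 i"] conjI allI) ((auto simp: out)[1], (auto simp: unit_flow_def)[1])
  next
    case 2
    then show ?thesis using sF ne j(1)
      by (intro exI[of _ "\<lambda>i. unit_flow ?s 1 i + (unit_flow j 1 i + unit_flow (j + (m + m)) 1 i)"] conjI allI) ((auto simp: out)[1], (auto simp: unit_flow_def)[1])
  next
    case 3
    then show ?thesis using sF ne j(1)
      by (intro exI[of _ "\<lambda>i. unit_flow ?s 1 i + unit_flow (j + (m + m)) 1 i"] conjI allI) ((auto simp: out)[1], (auto simp: unit_flow_def)[1])
  next
    case 4
    \<comment> \<open>The value \<open>-1\<close> below: edge \<open>j\<close> is traversed from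
      \<open>snd\<close> to \<open>fst\<close>, against its orientation.\<close>
    then show ?thesis using sF ne j(1)
      by (intro exI[of _ "\<lambda>i. unit_flow ?s 1 i + (unit_flow j (-1) i + unit_flow (j + m) 1 i)"] conjI allI) ((auto simp: out)[1], (auto simp: unit_flow_def)[1])
  qed
qed

text \<open>Choose an intact triangle for every spanned vertex and superpose the unit path flows. A
  triangle edge carries at most the paths of two vertices and a source edge at most one, which
  matches the capacities.\<close>

lemma length_spanned_le_value:
  assumes R: "nfi_feasible I (set R)"
  shows "real (length (spanned n es R)) \<le> nfi_value I (set R)"
proof -
  let ?F = "nfi_E I - set R" and ?W = "set (spanned n es R)"
  have fin: "finite ?F" using finite_nfi_E by blast
  have "\<forall>v\<in>?W. \<exists>j. j < m \<and> intact R m j \<and> (fst (es ! j) = v \<or> snd (es ! j) = v)"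
    using spanned_iff by blast
  from bchoice[OF this] obtain j
    where j: "\<And>v. v \<in> ?W \<Longrightarrow> j v < m \<and> intact R m (j v) \<and> (fst (es ! j v) = v \<or> snd (es ! j v) = v)"
    by blast
  have "\<exists>f. (\<forall>x. net_outflow I ?F f x = of_bool (x = n) - of_bool (x = n + 1)) \<and>
    (\<forall>i. \<bar>f i\<bar> \<le> of_bool (i = v + (m + (m + m))) + of_bool (i \<in> {j v, j v + m, j v + (m + m)}))"
    if "v \<in> ?W" for v
    using path_flow[OF R, of "j v" v] j[OF that] by blast
  then obtain f where f: "\<And>v x. v \<in> ?W \<Longrightarrow> net_outflow I ?F (f v) x = of_bool (x = n) - of_bool (x = n + 1)"
    and f_le: "\<And>v i. v \<in> ?W \<Longrightarrow>
      \<bar>f v i\<bar> \<le> of_bool (i = v + (m + (m + m))) + of_bool (i \<in> {j v, j v + m, j v + (m + m)})"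
    by metis
  define g where "g = (\<lambda>i. \<Sum>v\<in>?W. f v i)"
  have g: "net_outflow I ?F g x = real (card ?W) * (of_bool (x = n) - of_bool (x = n + 1))" for x
  proof -
    have "net_outflow I ?F g x = (\<Sum>v\<in>?W. net_outflow I ?F (f v) x)"
      unfolding net_outflow_incidence[OF fin] g_def sum_distrib_right by (rule sum.swap)
    also have "\<dots> = (\<Sum>v\<in>?W. of_bool (x = n) - of_bool (x = n + 1) :: real)" by (intro sum.cong refl f)
    finally show ?thesis by (simp only: sum_constant)
  qed
  have "\<bar>g i\<bar> \<le> capacity (nfi_edges I ! i)" if "i \<in> ?F" for i
  proof -
    have i: "i < m + m + m + n" using that by (simp add: nfi_E_I)
    have g_le: "\<bar>g i\<bar> \<le> (\<Sum>v\<in>?W. \<bar>f v i\<bar>)" unfolding g_def by (rule sum_abs)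
    from i show ?thesis
    proof (cases rule: edge_cases)
      case (triangle k)
      have "\<bar>f v i\<bar> \<le> of_bool (v \<in> {fst (es ! k), snd (es ! k)})" if v: "v \<in> ?W" for v
      proof -
        have jv: "j v < m" "v \<in> {fst (es ! j v), snd (es ! j v)}" using j[OF v] by auto
        \<comment> \<open>A path through position \<open>i\<close> uses triangle
          \<open>i mod m\<close>, which is \<open>k\<close>, so its starting vertex \<open>v\<close>
          is an end of edge \<open>k\<close>.\<close>
        have "i mod m = j v" if "i \<in> {j v, j v + m, j v + (m + m)}"
          using that jv(1) by (auto simp flip: add.assoc)
        then have "v \<in> {fst (es ! k), snd (es ! k)}" if "i \<in> {j v, j v + m, j v + (m + m)}"
          using jv(2) triangle(4) that by metis
        then have "of_bool (i \<in> {j v, j v + m, j v + (m + m)}) \<le> (of_bool (v \<in> {fst (es ! k), snd (es ! k)}) :: real)"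
          unfolding of_bool_less_eq_iff by (rule impI)
        moreover have "i \<noteq> v + (m + (m + m))" using triangle(3) by linarith
        then have "\<bar>f v i\<bar> \<le> of_bool (i \<in> {j v, j v + m, j v + (m + m)})"
          using f_le[OF v, of i] by (simp only: of_bool_eq add_0)
        ultimately show ?thesis by linarith
      qed
      then have "(\<Sum>v\<in>?W. \<bar>f v i\<bar>) \<le> (\<Sum>v\<in>?W. of_bool (v \<in> {fst (es ! k), snd (es ! k)}))"
        by (rule sum_mono)
      also have "\<dots> = card {v\<in>?W. v \<in> {fst (es ! k), snd (es ! k)}}"
        by (rule sum_of_bool_card) simp
      also have "\<dots> \<le> card {fst (es ! k), snd (es ! k)}" by (intro of_nat_mono card_mono) auto
      also have "\<dots> \<le> 2" by (simp add: card_insert_if)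
      finally show ?thesis using g_le triangle(3) by (simp add: triangle_edge)
    next
      case (source w)
      have "\<bar>f v i\<bar> \<le> of_bool (v = w)" if v: "v \<in> ?W" for v
      proof -
        have "i \<notin> {j v, j v + m, j v + (m + m)}" using j[OF v] source(3) by auto
        then show ?thesis using f_le[OF v, of i] source(2) by auto
      qed
      then have "(\<Sum>v\<in>?W. \<bar>f v i\<bar>) \<le> (\<Sum>v\<in>?W. of_bool (v = w))"
        by (rule sum_mono)
      also have "\<dots> \<le> 1" by (simp add: of_bool_def)
      finally show ?thesis using g_le source by simp
    qed
  qed
  then have "is_flow I ?F g" unfolding is_flow_def using g by simp
  from max_flow_value_ge[OF fin this] show ?thesis
    unfolding nfi_value_def using distinct_card[OF spanned(1), of n es R] by (simp add: g)
qed

subsection \<open>Every dense subgraph gives a feasible set\<close>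

text \<open>Separate \<open>S\<close> and the sink from everything else by removing the crossing
  triangle edges. What still crosses are the source edges into \<open>S\<close>, of total capacity
  \<open>card S\<close>.\<close>

lemma nfi_opt_le_card:
  assumes S: "S \<subseteq> {..<n}" and count: "2 * m \<le> b + 2 * card {j. j < m \<and> fst (es ! j) \<in> S \<and> snd (es ! j) \<in> S}"
  shows "nfi_opt I \<le> card S"
proof -
  let ?U = "{x. x < n * n \<and> x \<notin> S \<and> x \<noteq> n + 1}"
  define R where "R = {i \<in> {..<m + m + m}. incidence I i ?U \<noteq> 0}"
  let ?F = "nfi_E I - R"
  have fin: "finite ?F" using finite_nfi_E by blast
  have finS: "finite S" using S finite_subset by blast
  have U: "x \<in> ?U \<longleftrightarrow> x \<notin> S" if "x < n" for x using that n_plus_2_le by auto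
  have nU: "n \<in> ?U" using S n_ge_2 by auto
  let ?c = "\<lambda>i. of_bool (incidence I i ?U \<noteq> 0) :: nat"
  have "(\<Sum>i\<in>R. cost (nfi_edges I ! i)) = (\<Sum>i\<in>R. 1)"
    unfolding R_def by (intro sum.cong) (auto simp: triangle_edge)
  also have "\<dots> = (\<Sum>i<m + m + m. ?c i)"
    unfolding R_def by (simp add: sum_of_bool_card del: sum_of_bool_eq)
  also have "\<dots> = (\<Sum>j<m. ?c j + ?c (j + m) + ?c (j + (m + m)))"
    by (simp add: sum_lessThan_add sum.distrib)
  \<comment> \<open>With both ends in \<open>S\<close> the whole triangle is on the sink side; with
    one end or none there, exactly two of its edges cross.\<close>
  also have "\<dots> = (\<Sum>j<m. 2 - 2 * of_bool (fst (es ! j) \<in> S \<and> snd (es ! j) \<in> S))"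
  proof (rule sum.cong)
    fix j assume "j \<in> {..<m}"
    then have j: "j < m" by simp
    show "?c j + ?c (j + m) + ?c (j + (m + m)) = 2 - 2 * of_bool (fst (es ! j) \<in> S \<and> snd (es ! j) \<in> S)"
      unfolding incidence_I(1-3)[OF j] U[OF es_bounds(1)[OF j]] U[OF es_bounds(2)[OF j]] by simp
  qed simp
  also have "\<dots> + 2 * card {j. j < m \<and> fst (es ! j) \<in> S \<and> snd (es ! j) \<in> S} = 2 * m"
  proof -
    let ?q = "\<lambda>j. of_bool (fst (es ! j) \<in> S \<and> snd (es ! j) \<in> S) :: nat"
    have "card {j. j < m \<and> fst (es ! j) \<in> S \<and> snd (es ! j) \<in> S} = (\<Sum>j<m. ?q j)"
      by (simp add: sum_of_bool_card del: sum_of_bool_eq)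
    moreover have "(\<Sum>j<m. 2 - 2 * ?q j) + 2 * (\<Sum>j<m. ?q j) = (\<Sum>j<m. (2 - 2 * ?q j) + 2 * ?q j)"
      by (simp only: sum.distrib sum_distrib_left)
    moreover have "\<dots> = (\<Sum>j<m. 2)" by (intro sum.cong) auto
    ultimately show ?thesis by simp
  qed
  finally have "(\<Sum>i\<in>R. cost (nfi_edges I ! i)) \<le> b" using count by linarith
  then have feas: "nfi_feasible I R" unfolding nfi_feasible_def nfi_E_I R_def by auto
  have "nfi_value I R \<le> card S"
    unfolding nfi_value_def
  proof (rule max_flow_value_le)
    fix f assume f: "is_flow I ?F f"
    have "net_outflow I ?F f x = 0" if "x \<in> ?U - {n}" for x
      using f that by (auto simp: is_flow_def)
    \<comment> \<open>Conservation holds at every vertex of \<open>?U\<close> other than the source,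
      so the flow value equals the net flow out of \<open>?U\<close>.\<close>
    then have "net_outflow I ?F f (nfi_source I) = (\<Sum>x\<in>?U. net_outflow I ?F f x)"
      using nU by (subst sum.remove[of ?U n]) auto
    also have "\<dots> = (\<Sum>i\<in>?F. f i * incidence I i ?U)" by (rule sum_net_outflow[OF fin]) simp
    also have "\<dots> \<le> (\<Sum>i\<in>?F. of_bool (i \<in> (\<lambda>v. v + (m + (m + m))) ` S))"
    proof (rule sum_mono)
      fix i assume i: "i \<in> ?F"
      then have "i < m + m + m + n" by (simp add: nfi_E_I)
      then show "f i * incidence I i ?U \<le> of_bool (i \<in> (\<lambda>v. v + (m + (m + m))) ` S)"
      proof (cases rule: edge_cases)
        case (triangle k)
        then show ?thesis using i by (auto simp: R_def)
      next
        case (source v)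
        have "\<bar>f i\<bar> \<le> capacity (nfi_edges I ! i)" using f i by (auto simp: is_flow_def)
        moreover have "incidence I i ?U = of_bool (v \<in> S)"
          using source nU U[OF source(1)] by (simp only: incidence_I) auto
        ultimately show ?thesis using source by (cases "v \<in> S") auto
      qed
    qed
    also have "\<dots> = card {i\<in>?F. i \<in> (\<lambda>v. v + (m + (m + m))) ` S}"
      using fin by (simp add: sum_of_bool_card del: sum_of_bool_eq)
    also have "\<dots> \<le> card ((\<lambda>v. v + (m + (m + m))) ` S)"
      using finS by (intro of_nat_mono card_mono) auto
    also have "\<dots> \<le> card S" using finS by (intro of_nat_mono card_image_le)
    finally show "net_outflow I ?F f (nfi_source I) \<le> card S" .
  qed
  then show ?thesis using nfi_opt_le[OF feas] by linarith
qed

end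

section \<open>The approximation ratio\<close>

lemma finite_dks_feasible: "finite {W. dks_feasible H W}"
  by (rule finite_subset[of _ "Pow {..<dks_n H}"]) (auto simp: dks_feasible_def)

lemma dks_opt_attained:
  assumes "dks_valid H"
  shows "\<exists>W. dks_feasible H W \<and> dks_opt H = dks_value H W"
proof -
  have "dks_feasible H {..<dks_k H}" using assms by (auto simp: dks_feasible_def dks_valid_def)
  then have "dks_opt H \<in> dks_value H ` {W. dks_feasible H W}"
    unfolding dks_opt_def by (intro Max_in finite_imageI finite_dks_feasible) blast
  then show ?thesis by blast
qed

lemma edge_count_pos:
  assumes "0 < edge_count es W" "\<forall>e\<in>set es. fst e \<noteq> snd e"
  shows "2 \<le> card (set W)"
proof -
  have "filter (\<lambda>e. fst e \<in> set W \<and> snd e \<in> set W) es \<noteq> []" using assms(1) by (auto simp: edge_count_def)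
  then obtain e where "e \<in> set es" "fst e \<in> set W" "snd e \<in> set W" by (auto simp: filter_empty_conv)
  moreover from this have "fst e \<noteq> snd e" using assms(2) by blast
  ultimately show ?thesis using card_mono[of "set W" "{fst e, snd e}"] by simp
qed

text \<open>With \<open>w\<close> and \<open>k\<close> the two lengths, the density hypothesis
  leaves the factor \<open>w (w - 1) / (k (k - 1))\<close>. Here
  \<open>w (w - 1) \<le> w * w \<le> \<alpha>\<^sup>2 * k * k\<close>, and
  \<open>k \<le> 2 (k - 1)\<close> contributes the \<open>2\<close>.\<close>

lemma density_ratio:
  fixes \<alpha> :: real
  assumes "density es W \<le> density es W'" "2 \<le> length W'" "length W' < length W"
    and "real (length W) \<le> \<alpha> * length W'"
  shows "edge_count es W \<le> edge_count es W' * (2 * \<alpha>\<^sup>2)"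
proof -
  let ?k = "real (length W')" and ?w = "real (length W)"
  have k: "2 \<le> ?k" "?k < ?w" using assms(2,3) by auto
  have pos: "0 < ?k * (?k - 1)" "0 < ?w * (?w - 1)"
    using k by (intro mult_pos_pos; linarith)+
  have "?w * (?w - 1) \<le> ?w * ?w" using k by (intro mult_left_mono) auto
  also have "\<dots> \<le> (\<alpha> * ?k) * (\<alpha> * ?k)" using assms(4) k by (intro mult_mono) auto
  also have "\<dots> = \<alpha>\<^sup>2 * ?k * ?k" by (simp add: power2_eq_square)
  also have "\<dots> \<le> \<alpha>\<^sup>2 * ?k * (2 * (?k - 1))" using k by (intro mult_left_mono) auto
  finally have w: "?w * (?w - 1) \<le> 2 * \<alpha>\<^sup>2 * (?k * (?k - 1))" by (simp add: algebra_simps)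
  have "edge_count es W * (?k * (?k - 1)) \<le> edge_count es W' * (?w * (?w - 1))"
    using assms(1) pos by (simp add: density_def divide_simps mult.commute)
  also have "\<dots> \<le> edge_count es W' * (2 * \<alpha>\<^sup>2 * (?k * (?k - 1)))"
    using w by (intro mult_left_mono) auto
  finally have "edge_count es W * (?k * (?k - 1)) \<le> (edge_count es W' * (2 * \<alpha>\<^sup>2)) * (?k * (?k - 1))"
    by (simp add: mult.assoc)
  then show ?thesis using pos(1) by (simp only: mult_le_cancel_right_pos)
qed

lemma solution_approx:
  assumes valid: "dks_valid H"
    and r: "\<And>I. nfi_valid I \<Longrightarrow> nfi_feasible I (set (r I)) \<and>
      nfi_value I (set (r I)) \<le> \<alpha> (nfi_n I) * nfi_opt I"
  shows "real (dks_opt H) / (2 * (\<alpha> ((dks_n H)\<^sup>2))\<^sup>2) \<le> dks_value H (set (solution r H))"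
\<comment> \<open>For optimum \<open>0\<close> the left side is \<open>0\<close>, whatever
  \<open>\<alpha>\<close> is. Otherwise some feasible set contains an edge, which forces
  \<open>k \<ge> 2\<close>.\<close>
proof (cases "dks_opt H = 0")
  case False
  let ?es = "dks_edges H" and ?m = "length (dks_edges H)" and ?n = "dks_n H" and ?k = "dks_k H"
  let ?d = "dks_opt H" and ?\<alpha> = "\<alpha> ((dks_n H)\<^sup>2)"
  obtain S where S: "dks_feasible H S" "?d = dks_value H S" using dks_opt_attained[OF valid] by blast
  then have "finite S" by (auto simp: dks_feasible_def intro: finite_subset)
  then obtain xs where xs: "set xs = S" using finite_list by blast
  have d: "?d = edge_count ?es xs" using S(2) xs dks_value_edge_count[OF valid, of xs] by simp
  have ne: "\<forall>e\<in>set ?es. fst e \<noteq> snd e" using valid by (auto simp: dks_valid_def)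
  have k: "card S = ?k" "2 \<le> ?k"
    using S(1) edge_count_pos[OF _ ne, of xs] d False xs by (auto simp: dks_feasible_def)
  have dm: "?d \<le> ?m" unfolding d edge_count_def by (rule length_filter_le)
  \<comment> \<open>The trial for \<open>l = ?d\<close>; a positive optimum puts it inside the range
    of trials made by \<open>solution\<close>.\<close>
  define i where "i = ?m - ?d"
  have i: "i < ?m" "2 * ?m \<le> (i + i) + 2 * ?d" using dm False by (auto simp: i_def)
  interpret reduction H "i + i" by standard (rule valid)
  let ?I = "interdiction H (i + i)"
  let ?W = "spanned ?n ?es (r ?I)" and ?C = "candidate H (r ?I)"
  have R: "nfi_feasible ?I (set (r ?I))" "nfi_value ?I (set (r ?I)) \<le> ?\<alpha> * nfi_opt ?I"
    using r[OF nfi_valid_I] by (simp_all add: power2_eq_square)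
  have opt_k: "nfi_opt ?I \<le> ?k"
    using nfi_opt_le_card[of S] S(1) i(2) unfolding d edge_count_nth xs k(1)[symmetric]
    by (simp add: dks_feasible_def)
  \<comment> \<open>Leads to \<open>1 \<le> ?\<alpha>\<close>: a budget below \<open>2 * ?m\<close>
    always leaves an intact triangle and hence positive flow, and no feasible solution has value
    below the optimum.\<close>
  have opt_1: "1 \<le> nfi_opt ?I"
  proof -
    obtain R' where R': "nfi_feasible ?I R'" "nfi_opt ?I = nfi_value ?I R'" using nfi_opt_attained by blast
    then have "finite R'" using finite_subset[OF _ finite_nfi_E] by (auto simp: nfi_feasible_def)
    then obtain l where l: "set l = R'" using finite_list by blast
    have "0 < edge_count ?es (spanned ?n ?es l)"
      using edge_count_spanned[of l] R'(1) l i(1) by simp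
    then have "1 \<le> length (spanned ?n ?es l)" by (cases "spanned ?n ?es l") (auto simp: edge_count_def)
    then show ?thesis using length_spanned_le_value[of l] R' l by simp
  qed
  have "nfi_opt ?I \<le> ?\<alpha> * nfi_opt ?I" using nfi_opt_le[OF R(1)] R(2) by linarith
  then have \<alpha>: "1 \<le> ?\<alpha>" using opt_1 by simp
  have W_len: "real (length ?W) \<le> ?\<alpha> * ?k"
  proof -
    have "real (length ?W) \<le> ?\<alpha> * nfi_opt ?I" using length_spanned_le_value[OF R(1)] R(2) by linarith
    also have "\<dots> \<le> ?\<alpha> * ?k" using opt_k \<alpha> by (intro mult_left_mono) auto
    finally show ?thesis .
  qed
  have W_count: "?d \<le> edge_count ?es ?W" using edge_count_spanned[OF R(1)] dm unfolding i_def by linarith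
  have "edge_count ?es ?W \<le> edge_count ?es ?C * (2 * ?\<alpha>\<^sup>2)"
    using candidate(4)[OF valid, of "r ?I"]
  proof
    assume "edge_count ?es ?W \<le> edge_count ?es ?C"
    moreover have "1 \<le> 2 * ?\<alpha>\<^sup>2" using one_le_power[OF \<alpha>, of 2] by linarith
    ultimately show ?thesis
      using mult_mono[of "real (edge_count ?es ?W)" "real (edge_count ?es ?C)" 1 "2 * ?\<alpha>\<^sup>2"] by simp
  next
    assume "?k < length ?W \<and> (2 \<le> ?k \<longrightarrow> density ?es ?W \<le> density ?es ?C)"
    then show ?thesis
      using k(2) W_len by (intro density_ratio) (simp_all add: candidate(3)[OF valid])
  qed
  moreover have "edge_count ?es ?C \<le> dks_value H (set (solution r H))"
    using solution(3)[OF valid i(1)] .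
  then have "edge_count ?es ?C * (2 * ?\<alpha>\<^sup>2) \<le> dks_value H (set (solution r H)) * (2 * ?\<alpha>\<^sup>2)"
    by (intro mult_right_mono) auto
  ultimately have "real ?d \<le> dks_value H (set (solution r H)) * (2 * ?\<alpha>\<^sup>2)"
    using W_count by linarith
  then show ?thesis using \<alpha> by (simp add: divide_le_eq)
qed simp

theorem theorem1:
  fixes \<alpha> :: "nat \<Rightarrow> real"
  assumes "\<exists>A. nfi_approx_algorithm \<alpha> A"
  shows "\<exists>A. dks_approx_algorithm (\<lambda>n. 2 * (\<alpha> (n ^ 2)) ^ 2) A"
proof -
  obtain A where "nfi_approx_algorithm \<alpha> A" using assms by blast
  then obtain v where v: "poly_comp {I. nfi_valid I} enc_nfi v" and
    good: "\<And>I. nfi_valid I \<Longrightarrow>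
      \<exists>R. encodes_set (v I) R \<and> nfi_feasible I R \<and> nfi_value I R \<le> \<alpha> (nfi_n I) * nfi_opt I"
    unfolding nfi_approx_algorithm_def by (rule poly_comp_algorithm) (rule that)
  \<comment> \<open>Later functions work on lists, so for each valid instance the list behind the
    returned value \<open>v I\<close> is fixed.\<close>
  have "\<exists>xs. nfi_valid I \<longrightarrow> v I = enc_list VNum xs \<and> nfi_feasible I (set xs) \<and>
      nfi_value I (set xs) \<le> \<alpha> (nfi_n I) * nfi_opt I" for I
    using good[of I] by (auto simp: encodes_set_def)
  then obtain r where r: "\<And>I. nfi_valid I \<Longrightarrow> v I = enc_list VNum (r I) \<and> nfi_feasible I (set (r I)) \<and>
      nfi_value I (set (r I)) \<le> \<alpha> (nfi_n I) * nfi_opt I"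
    by metis
  have "poly_comp {I. nfi_valid I} enc_nfi (\<lambda>I. enc_list VNum (r I))"
    using v by (rule poly_comp_cong) (simp add: r)
  then have "poly_comp {H. dks_valid H} enc_dks (\<lambda>H. enc_list VNum (solution r H))"
    by (rule poly_comp_solution) (rule reduction.nfi_valid_I[OF reduction.intro])
  then show ?thesis
    unfolding dks_approx_algorithm_def
  proof (rule algorithm_poly_comp)
    fix H assume H: "dks_valid H"
    have "encodes_set (enc_list VNum (solution r H)) (set (solution r H))"
      using solution(1)[OF H] by (auto simp: encodes_set_def)
    then show "\<exists>W. encodes_set (enc_list VNum (solution r H)) W \<and> dks_feasible H W \<and>
        real (dks_opt H) / (2 * (\<alpha> ((dks_n H)\<^sup>2))\<^sup>2) \<le> real (dks_value H W)"
      using solution(2)[OF H] solution_approx[OF H, of r \<alpha>] r by blast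
  qed
qed

end
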